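(* Let $X$ and $Y$ be finite types and let $\rhd$ be a primitive recursive wellfounded relation on $X$ such that wellfounded recursion over $\rhd$ is definable in system $\mathsf T$. Then the fixpoint, in the partial continuous functionals, of the defining equation $$\mathrm{EOR}^{H,F}_{(X,\rhd),Y}(u)=_Y H(\mathrm{spec}(\alpha,F)),\qquad \alpha:=\lambda n.\,\bigl\langle u_n,\ \lambda v.\,(\mathrm{EOR}^{H,F}_{(X,\rhd),Y}([u](n)\ast v)\text{ if }v_0\lhd u_n)\bigr\rangle$$ (in arguments $H:(X\times(X^{\mathbb N}\to Y))^{\mathbb N}\to Y$, $F:(X\times(X^{\mathbb N}\to Y))^{\mathbb N}\to\mathbb N$, $u:X^{\mathbb N}$) is total, and hence $\mathrm{EOR}_{(X,\rhd),Y}$ exists in the type structure of total continuous functionals.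
   Context: Finite types are built from $\mathbb B,\mathbb N$ by products, finite sequences $X^*$ and function types $X\to Y$; $X^{\mathbb N}:=\mathbb N\to X$. System $\mathsf T$ is Gödel's simply typed $\lambda$-calculus of primitive recursive functionals in all finite types. Each type has a canonical zero object ($0_{\mathbb N}=0$, $0_{\mathbb B}=0$, $0_{X\times Y}=\langle 0_X,0_Y\rangle$, $0_{X^*}=\langle\rangle$, $0_{X\to Y}=\lambda x.0_Y$). $[u](n):=\langle u_0,\ldots,u_{n-1}\rangle$; $s\ast v$ is concatenation. $(E\text{ if }A)$ means $E$ if $A$ holds and the zero object otherwise (evaluated lazily, so $E$ is not evaluated if $A$ is false). For $\alpha:Z^{\mathbb N}$, $m:\mathbb N$: $\mathrm{ext}(\alpha,m)$ is the sequence with $n$-th entry $\alpha_n$ if $n<m$ and $0_Z$ otherwise. For $F:Z^{\mathbb N}\to\mathbb N$: $\mathrm{spec}(\alpha,F)$ has $n$-th entry $0_Z$ if $(\exists m\le n)(F(\mathrm{ext}(\alpha,m))<m)$, and $\alpha_n$ otherwise; on partial arguments the bounded search is carried out for $m=0,1,2,\ldots$ in order and stops as soon as some $m$ satisfying the condition is found. The partial continuous functionals are the Scott--Ershov domains of continuous functionals of finite type over the flat domains $\mathbb B_\bot,\mathbb N_\bot$ (function types interpreted by continuous function spaces, products and finite sequences in the usual way). Total elements are defined hereditarily: the total elements of base types are those different from $\bot$, and an element of type $X\to Y$ is total if it maps total elements to total elements (similarly for products and finite sequences). The total continuous functionals (Kleene--Kreisel) are the extensional collapse of the total elements. Every recursive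 defining equation has a (least) fixpoint in the partial continuous functionals. *)

theory Defs
  imports "HOL-Library.FSet"
begin

section \<open>Finite types\<close>

datatype ty =
    Boolean
  | Natural
  | Times ty ty  (infixr \<open>\<otimes>\<close> 70)
  | Star ty
  | Arrow ty ty  (infixr \<open>\<rightarrow>\<close> 65)

abbreviation Stream :: "ty \<Rightarrow> ty" where
  "Stream X \<equiv> Natural \<rightarrow> X"


section \<open>The partial continuous functionals\<close>

text \<open>
  The Scott domains over the flat booleans and naturals are presented by Scott's information
  systems, so that the domains of all finite types live in the single type \<open>tok set\<close>: a partial
  functional is the ideal (consistent, deductively closed set) of the finite pieces of information
  true of it, the order is inclusion and the bottom element is the empty ideal.

  \<open>Step U b\<close> says that a function maps every argument containing \<open>U\<close> to a value containing \<open>b\<close>.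
  Products are unlifted. The domain of finite sequences is the lifted disjoint union of the
  finite powers: \<open>Len n\<close> says that the length is \<open>n\<close>, and \<open>Ent n i a\<close> that moreover \<open>a\<close> holds
  of the \<open>i\<close>-th entry.
\<close>

datatype tok =
    BoolTok bool
  | NatTok nat
  | LeftTok tok
  | RightTok tok
  | Len nat
  | Ent nat nat tok
  | Step "tok fset" tok

primrec con :: "ty \<Rightarrow> tok set \<Rightarrow> bool" where
  "con Boolean W \<longleftrightarrow> (\<forall>a\<in>W. \<forall>b\<in>W. a = b)"
| "con Natural W \<longleftrightarrow> (\<forall>a\<in>W. \<forall>b\<in>W. a = b)"
| "con (X \<otimes> Y) W \<longleftrightarrow> con X {a. LeftTok a \<in> W} \<and> con Y {b. RightTok b \<in> W}"
| "con (Star X) W \<longleftrightarrow>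
     (\<exists>n. (\<forall>t\<in>W. t = Len n \<or> (\<exists>i a. t = Ent n i a)) \<and> (\<forall>i. con X {a. Ent n i a \<in> W}))"
| "con (X \<rightarrow> Y) W \<longleftrightarrow>
     (\<forall>I\<subseteq>W. con X (\<Union>{fset U | U. \<exists>b. Step U b \<in> I}) \<longrightarrow> con Y {b. \<exists>U. Step U b \<in> I})"

primrec entails :: "ty \<Rightarrow> tok set \<Rightarrow> tok \<Rightarrow> bool" where
  "entails Boolean W t \<longleftrightarrow> t \<in> W"
| "entails Natural W t \<longleftrightarrow> t \<in> W"
| "entails (X \<otimes> Y) W t \<longleftrightarrow>
     (\<exists>a. t = LeftTok a \<and> entails X {a. LeftTok a \<in> W} a) \<or>
     (\<exists>b. t = RightTok b \<and> entails Y {b. RightTok b \<in> W} b)"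
| "entails (Star X) W t \<longleftrightarrow>
     (\<exists>n. t = Len n \<and> (Len n \<in> W \<or> (\<exists>i a. Ent n i a \<in> W))) \<or>
     (\<exists>n i a. t = Ent n i a \<and> entails X {a. Ent n i a \<in> W} a)"
| "entails (X \<rightarrow> Y) W t \<longleftrightarrow>
     (\<exists>U b. t = Step U b \<and>
        entails Y {b'. \<exists>U'. Step U' b' \<in> W \<and> (\<forall>a\<in>fset U'. entails X (fset U) a)} b)"

primrec toks :: "ty \<Rightarrow> tok set" where
  "toks Boolean = range BoolTok"
| "toks Natural = range NatTok"
| "toks (X \<otimes> Y) = LeftTok ` toks X \<union> RightTok ` toks Y"
| "toks (Star X) = range Len \<union> {Ent n i a | n i a. i < n \<and> a \<in> toks X}"
| "toks (X \<rightarrow> Y) = {Step U b | U b. fset U \<subseteq> toks X \<and> con X (fset U) \<and> b \<in> toks Y}"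

definition Dom :: "ty \<Rightarrow> tok set set" where
  "Dom X = {x. x \<subseteq> toks X \<and>
               (\<forall>W\<subseteq>x. finite W \<longrightarrow> con X W \<and> (\<forall>a\<in>toks X. entails X W a \<longrightarrow> a \<in> x))}"

text \<open>
  \<open>app\<close> identifies \<^term>\<open>Dom (X \<rightarrow> Y)\<close> with the continuous functions from \<^term>\<open>Dom X\<close> to
  \<^term>\<open>Dom Y\<close>; the inverse is \<open>lam X\<close>, which describes a continuous \<open>g\<close> by its values at the
  compact elements, i.e. at the deductive closures of finite consistent sets.
\<close>

definition app :: "tok set \<Rightarrow> tok set \<Rightarrow> tok set"  (infixl \<open>\<bullet>\<close> 90) where
  "f \<bullet> x = {b. \<exists>U. Step U b \<in> f \<and> fset U \<subseteq> x}"

definition ded_closure :: "ty \<Rightarrow> tok set \<Rightarrow> tok set" where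
  "ded_closure X W = {a \<in> toks X. entails X W a}"

definition lam :: "ty \<Rightarrow> (tok set \<Rightarrow> tok set) \<Rightarrow> tok set" where
  "lam X g = {Step U b | U b. fset U \<subseteq> toks X \<and> con X (fset U) \<and> b \<in> g (ded_closure X (fset U))}"

text \<open>
  The lemmas \<open>app_Dom\<close>, \<open>scott_cont_app\<close>, \<open>lam_Dom\<close>, \<open>app_lam\<close>, \<open>lam_app\<close> and \<open>app_le_iff\<close> below
  make this precise; \<open>scott_cont\<close> is continuity, as determination by the values at the compact
  approximations of the argument.
\<close>

lemma con_mono: "con X W \<Longrightarrow> V \<subseteq> W \<Longrightarrow> con X V"
proof (induction X arbitrary: V W)
  case (Times X Y)
  have "con X {a. LeftTok a \<in> V}" by (rule Times.IH(1)[of "{a. LeftTok a \<in> W}"]) (use Times.prems in auto)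
  moreover have "con Y {a. RightTok a \<in> V}" by (rule Times.IH(2)[of "{a. RightTok a \<in> W}"]) (use Times.prems in auto)
  ultimately show ?case by simp
next
  case (Star X)
  from Star.prems obtain n where n: "\<forall>t\<in>W. t = Len n \<or> (\<exists>i a. t = Ent n i a)" "\<forall>i. con X {a. Ent n i a \<in> W}" by auto
  have "con X {a. Ent n i a \<in> V}" for i by (rule Star.IH[of "{a. Ent n i a \<in> W}"]) (use n Star.prems in auto)
  then show ?case using n Star.prems(2) unfolding con.simps by (intro exI[of _ n] conjI allI) blast+
next
  case (Arrow X Y)
  have I: "I \<subseteq> W" if "I \<subseteq> V" for I using that Arrow.prems(2) by (rule subset_trans)
  show ?case unfolding con.simps
    by (intro allI impI) (rule Arrow.prems(1)[unfolded con.simps, rule_format, OF I])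
qed auto

lemma entails_mono: "entails X V a \<Longrightarrow> V \<subseteq> W \<Longrightarrow> entails X W a"
proof (induction X arbitrary: V W a)
  case (Times X Y)
  have 1: "entails X {a. LeftTok a \<in> W} a" if "entails X {a. LeftTok a \<in> V} a" for a by (rule Times.IH(1)[OF that]) (use Times.prems in auto)
  have 2: "entails Y {a. RightTok a \<in> W} a" if "entails Y {a. RightTok a \<in> V} a" for a by (rule Times.IH(2)[OF that]) (use Times.prems in auto)
  from Times.prems(1) 1 2 show ?case by (simp only: entails.simps) blast
next
  case (Star X)
  have 1: "entails X {a. Ent n i a \<in> W} a" if "entails X {a. Ent n i a \<in> V} a" for n i a by (rule Star.IH[OF that]) (use Star.prems in auto)
  from Star.prems 1 show ?case by (simp only: entails.simps) blast
next
  case (Arrow X Y)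
  from Arrow.prems obtain U b where a: "a = Step U b" and e: "entails Y {b'. \<exists>U'. Step U' b' \<in> V \<and> (\<forall>a\<in>fset U'. entails X (fset U) a)} b" by auto
  have "entails Y {b'. \<exists>U'. Step U' b' \<in> W \<and> (\<forall>a\<in>fset U'. entails X (fset U) a)} b"
    by (rule Arrow.IH(2)[OF e]) (use Arrow.prems in blast)
  then show ?case using a by simp
qed auto

lemma entails_empty: "\<not> entails X {} a"
  by (induction X arbitrary: a) auto

lemma entails_refl: "a \<in> W \<Longrightarrow> a \<in> toks X \<Longrightarrow> entails X W a"
proof (induction X arbitrary: W a)
  case (Arrow X Y)
  from Arrow.prems obtain U b where a: "a = Step U b" "fset U \<subseteq> toks X" "b \<in> toks Y" by auto
  have "entails Y {b'. \<exists>U'. Step U' b' \<in> W \<and> (\<forall>a\<in>fset U'. entails X (fset U) a)} b"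
    by (rule Arrow.IH(2)) (use a Arrow in blast)+
  then show ?case using a by simp
qed (auto; blast)+

lemma entails_trans: "entails X V b \<Longrightarrow> (\<And>a. a \<in> V \<Longrightarrow> entails X W a) \<Longrightarrow> entails X W b"
proof (induction X arbitrary: V W b)
  case (Times X Y)
  have l: "entails X {a. LeftTok a \<in> W} a" if "LeftTok a \<in> V" for a using Times.prems(2)[OF that] by simp
  have r: "entails Y {a. RightTok a \<in> W} a" if "RightTok a \<in> V" for a using Times.prems(2)[OF that] by simp
  from Times.prems(1) show ?case
    by (simp only: entails.simps) (use Times.IH l r in blast)
next
  case (Star X)
  have e: "entails X {a. Ent n i a \<in> W} a" if "Ent n i a \<in> V" for n i a using Star.prems(2)[OF that] by simp
  have ne: "\<exists>i a. Ent n i a \<in> W" if "Ent n i a \<in> V" for n i a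
    using e[OF that] entails_empty[of X a] by (cases "{a. Ent n i a \<in> W} = {}") auto
  have l: "Len n \<in> W \<or> (\<exists>i a. Ent n i a \<in> W)" if "Len n \<in> V" for n using Star.prems(2)[OF that] by simp
  have i: "entails X {a. Ent n i a \<in> W} a" if "entails X {a. Ent n i a \<in> V} a" for n i a
    by (rule Star.IH[OF that]) (use e in auto)
  from Star.prems(1) show ?case
    by (simp only: entails.simps) (use l ne i in blast)
next
  case (Arrow X Y)
  from Arrow.prems obtain U c where b: "b = Step U c" and e: "entails Y {b'. \<exists>U'. Step U' b' \<in> V \<and> (\<forall>a\<in>fset U'. entails X (fset U) a)} c" by auto
  have "entails Y {b'. \<exists>U'. Step U' b' \<in> W \<and> (\<forall>a\<in>fset U'. entails X (fset U) a)} c"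
  proof (rule Arrow.IH(2)[OF e])
    fix d assume "d \<in> {b'. \<exists>U'. Step U' b' \<in> V \<and> (\<forall>a\<in>fset U'. entails X (fset U) a)}"
    then obtain U' where U': "Step U' d \<in> V" "\<forall>a\<in>fset U'. entails X (fset U) a" by auto
    from Arrow.prems(2)[OF U'(1)] have
     e: "entails Y {b'. \<exists>U''. Step U'' b' \<in> W \<and> (\<forall>a\<in>fset U''. entails X (fset U') a)} d" by simp
    show "entails Y {b'. \<exists>U'. Step U' b' \<in> W \<and> (\<forall>a\<in>fset U'. entails X (fset U) a)} d"
      by (rule entails_mono[OF e]) (use Arrow.IH(1) U' in blast)
  qed
  then show ?case using b by simp
qed auto

lemma con_ArrowD: "con (X \<rightarrow> Y) W \<Longrightarrow> I \<subseteq> W \<Longrightarrow> con X (\<Union>{fset U | U. \<exists>b. Step U b \<in> I}) \<Longrightarrow> con Y {b. \<exists>U. Step U b \<in> I}"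
  unfolding con.simps by (drule spec, drule (1) mp, drule (1) mp)

lemma entails_con: "con X W \<Longrightarrow> (\<And>a. a \<in> V \<Longrightarrow> entails X W a) \<Longrightarrow> con X V"
proof (induction X arbitrary: V W)
  case (Times X Y)
  have "con X {a. LeftTok a \<in> V}" "con Y {b. RightTok b \<in> V}"
    using Times.prems by (auto intro!: Times.IH(1)[of "{a. LeftTok a \<in> W}"] Times.IH(2)[of "{a. RightTok a \<in> W}"])
  then show ?case by simp
next
  case (Star X)
  from Star.prems obtain n where n: "\<forall>t\<in>W. t = Len n \<or> (\<exists>i a. t = Ent n i a)" "\<forall>i. con X {a. Ent n i a \<in> W}" by auto
  have 1: "t = Len n \<or> (\<exists>i a. t = Ent n i a)" if "t \<in> V" for t
  proof -
    have ne: "\<exists>a. Ent m i a \<in> W" if "entails X {a. Ent m i a \<in> W} a" for m i a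
      using that entails_empty[of X a] by (cases "{a. Ent m i a \<in> W} = {}") auto
    have w: "m = n" if "Ent m i a \<in> W" for m i a using n(1) that by auto
    have w': "m = n" if "Len m \<in> W" for m using n(1) that by auto
    from Star.prems(2)[OF that] show ?thesis
      by (simp only: entails.simps) (use ne w w' in blast)
  qed
  have "con X {a. Ent n i a \<in> V}" for i
    by (rule Star.IH[of "{a. Ent n i a \<in> W}"]) (use n Star.prems(2) in auto)
  then show ?case using 1 unfolding con.simps by (intro exI[of _ n] conjI ballI allI)
next
  case (Arrow X Y)
  show ?case
  proof (simp, intro allI impI)
    fix I assume I: "I \<subseteq> V" and c: "con X (\<Union>{fset U | U. \<exists>b. Step U b \<in> I})"
    define S where "S = \<Union>{fset U | U. \<exists>b. Step U b \<in> I}"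
    define J where "J = {Step U b | U b. Step U b \<in> W \<and> (\<forall>a\<in>fset U. entails X S a)}"
    have "con X (\<Union>{fset U | U. \<exists>b. Step U b \<in> J})"
      by (rule Arrow.IH(1)[OF c]) (auto simp: J_def S_def)
    then have cJ: "con Y {b. \<exists>U. Step U b \<in> J}" by (intro con_ArrowD[OF Arrow.prems(1)]) (auto simp: J_def)
    show "con Y {b. \<exists>U. Step U b \<in> I}"
    proof (rule Arrow.IH(2)[OF cJ])
      fix b assume "b \<in> {b. \<exists>U. Step U b \<in> I}"
      then obtain U where U: "Step U b \<in> I" by auto
      have US: "fset U \<subseteq> S" using U by (auto simp: S_def)
      from Arrow.prems(2) U I have "entails Y {b'. \<exists>U'. Step U' b' \<in> W \<and> (\<forall>a\<in>fset U'. entails X (fset U) a)} b" by auto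
      then show "entails Y {b. \<exists>U. Step U b \<in> J} b"
        by (rule entails_mono) (use US in \<open>auto simp: J_def intro: entails_mono\<close>)
    qed
  qed
qed auto

lemma DomD:
  assumes "x \<in> Dom X" "W \<subseteq> x"
  shows "finite W \<Longrightarrow> con X W" "W \<subseteq> toks X" "finite W \<Longrightarrow> entails X W a \<Longrightarrow> a \<in> toks X \<Longrightarrow> a \<in> x"
  using assms unfolding Dom_def by blast+

lemma con_empty: "con X {}" by (induction X) auto

lemma con_single: "a \<in> toks X \<Longrightarrow> con X {a}"
proof (induction X arbitrary: a)
  case (Times X Y)
  then show ?case by (auto simp: con_empty)
next
  case (Star X)
  have "con X {a. Ent n i a = Ent m j b}" if "b \<in> toks X" for n i m j b
    using Star.IH[OF that] con_empty by (cases "n = m \<and> i = j") auto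
  then show ?case using Star.prems by (auto simp: con_empty)
next
  case (Arrow X Y)
  then obtain U b where a: "a = Step U b" "b \<in> toks Y" by auto
  have "con Y {b. \<exists>U. Step U b \<in> I}" if "I \<subseteq> {a}" for I
    by (rule con_mono[OF Arrow.IH(2)[OF a(2)]]) (use that a in auto)
  then show ?case by simp
qed auto

lemma ded_closure_Dom:
  assumes "con X W" "W \<subseteq> toks X" shows "ded_closure X W \<in> Dom X"
  using assms unfolding Dom_def ded_closure_def
  by (auto intro: entails_con entails_trans)

lemma app_Dom:
  assumes f: "f \<in> Dom (X \<rightarrow> Y)" and x: "x \<in> Dom X" shows "f \<bullet> x \<in> Dom Y"
proof -
  have t: "f \<bullet> x \<subseteq> toks Y" using f by (auto simp: Dom_def app_def)
  show ?thesis unfolding Dom_def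
    mem_Collect_eq
  proof (rule conjI[OF t], intro allI conjI ballI impI)
    fix W assume W: "W \<subseteq> f \<bullet> x" "finite W"
    then have "\<forall>b\<in>W. \<exists>U. Step U b \<in> f \<and> fset U \<subseteq> x" by (auto simp: app_def)
    then obtain u where u: "\<And>b. b \<in> W \<Longrightarrow> Step (u b) b \<in> f \<and> fset (u b) \<subseteq> x" by metis
    define S where "S = (\<Union>b\<in>W. fset (u b))"
    have S1: "finite S" "S \<subseteq> x" using W u by (auto simp: S_def)
    have S: "finite S" "S \<subseteq> x" "S \<subseteq> toks X" "con X S" using S1 x unfolding Dom_def by blast+
    define I where "I = (\<lambda>b. Step (u b) b) ` W"
    have I: "I \<subseteq> f" "finite I" using u W by (auto simp: I_def)
    then have cI: "con (X \<rightarrow> Y) I" using DomD(1)[OF f] by blast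
    have eq: "\<Union>{fset U | U. \<exists>b. Step U b \<in> I} = S" "{b. \<exists>U. Step U b \<in> I} = W" by (auto simp: I_def S_def)
    show cW: "con Y W" using con_ArrowD[OF cI order_refl] eq S(4) by simp
    fix b assume b: "b \<in> toks Y" "entails Y W b"
    obtain SS where SS: "fset SS = S" using S(1) by (metis fset_cases[of S] mem_Collect_eq)
    have st: "Step SS b \<in> toks (X \<rightarrow> Y)" using b S SS by simp
    have "entails (X \<rightarrow> Y) I (Step SS b)"
    proof -
      have "W \<subseteq> {b'. \<exists>U'. Step U' b' \<in> I \<and> (\<forall>a\<in>fset U'. entails X (fset SS) a)}"
      proof
        fix b' assume b': "b' \<in> W"
        have "fset (u b') \<subseteq> S" using b' by (auto simp: S_def)
        then show "b' \<in> {b'. \<exists>U'. Step U' b' \<in> I \<and> (\<forall>a\<in>fset U'. entails X (fset SS) a)}"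
          using b' S(3) by (auto simp: I_def SS intro!: exI[of _ "u b'"] entails_refl)
      qed
      then show ?thesis using b(2) by (auto intro: entails_mono)
    qed
    then have "Step SS b \<in> f" using DomD(3)[OF f I] st by blast
    then show "b \<in> f \<bullet> x" using SS S by (auto simp: app_def)
  qed
qed

definition scott_cont :: "ty \<Rightarrow> ty \<Rightarrow> (tok set \<Rightarrow> tok set) \<Rightarrow> bool" where
 "scott_cont X Y g \<longleftrightarrow> (\<forall>x\<in>Dom X. g x \<in> Dom Y \<and> g x = (\<Union>W\<in>{W. finite W \<and> W \<subseteq> x}. g (ded_closure X W)))"

lemma ex_fset: "finite S \<Longrightarrow> \<exists>F. fset F = S"
  by (metis fset_cases[of S] mem_Collect_eq)

lemma scott_cont_mono:
  assumes g: "scott_cont X Y g" and "x \<in> Dom X" "y \<in> Dom X" "x \<subseteq> y" shows "g x \<subseteq> g y"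
proof -
  have "g x = (\<Union>W\<in>{W. finite W \<and> W \<subseteq> x}. g (ded_closure X W))" and "g y = (\<Union>W\<in>{W. finite W \<and> W \<subseteq> y}. g (ded_closure X W))"
    using g[unfolded scott_cont_def, rule_format, THEN conjunct2] assms(2,3) by blast+
  moreover have "{W. finite W \<and> W \<subseteq> x} \<subseteq> {W. finite W \<and> W \<subseteq> y}" using assms(4) by blast
  ultimately show ?thesis by (simp only: UN_mono[OF _ order_refl])
qed

lemma app_lam: assumes g: "scott_cont X Y g" and x: "x \<in> Dom X" shows "lam X g \<bullet> x = g x"
proof -
  have gx: "g x = (\<Union>W\<in>{W. finite W \<and> W \<subseteq> x}. g (ded_closure X W))" using g x by (auto simp: scott_cont_def)
  show ?thesis 
  proof (intro set_eqI iffI)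
    fix b assume "b \<in> lam X g \<bullet> x" then obtain U where "fset U \<subseteq> x" "b \<in> g (ded_closure X (fset U))" by (auto simp: app_def lam_def)
    then show "b \<in> g x" unfolding gx by (auto intro!: exI[of _ "fset U"])
  next
    fix b assume "b \<in> g x"
    then obtain W where W: "finite W" "W \<subseteq> x" "b \<in> g (ded_closure X W)" by (subst (asm) gx) auto
    obtain F where F: "fset F = W" using ex_fset W by auto
    show "b \<in> lam X g \<bullet> x" unfolding app_def lam_def
      using W DomD(1)[OF x W(2,1)] DomD(2)[OF x W(2)] unfolding F[symmetric] by blast
  qed
qed

lemma lam_Dom: assumes g: "scott_cont X Y g" shows "lam X g \<in> Dom (X \<rightarrow> Y)"
proof -
  have gd: "g (ded_closure X (fset U)) \<in> Dom Y" if "fset U \<subseteq> toks X" "con X (fset U)" for U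
    using ded_closure_Dom[OF that(2,1)] g by (auto simp: scott_cont_def)
  have t: "lam X g \<subseteq> toks (X \<rightarrow> Y)"
  proof
    fix t assume "t \<in> lam X g"
    then obtain U b where u: "t = Step U b" "fset U \<subseteq> toks X" "con X (fset U)" "b \<in> g (ded_closure X (fset U))" by (auto simp: lam_def)
    from gd[OF u(2,3)] u(4) have "b \<in> toks Y" unfolding Dom_def by blast
    with u show "t \<in> toks (X \<rightarrow> Y)" by simp
  qed
  show ?thesis unfolding Dom_def mem_Collect_eq
  proof (rule conjI[OF t], intro conjI allI ballI impI)
    fix W assume W: "W \<subseteq> lam X g" "finite W"
    show "con (X \<rightarrow> Y) W"
      unfolding con.simps
    proof (intro allI impI)
      fix I assume I: "I \<subseteq> W" and c: "con X (\<Union>{fset U | U. \<exists>b. Step U b \<in> I})"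
      define S where "S = \<Union>{fset U | U. \<exists>b. Step U b \<in> I}"
      have fI: "finite I" using I W finite_subset by auto
      have S_eq: "S = (\<Union>t\<in>I. case t of Step U b \<Rightarrow> fset U | _ \<Rightarrow> {})" by (force simp: S_def split: tok.splits)
      have fS: "finite S" unfolding S_eq using fI by (auto split: tok.splits)
      have S: "S \<subseteq> toks X" using I W by (fastforce simp: S_def lam_def)
      have D: "ded_closure X S \<in> Dom X" using ded_closure_Dom c S S_def by auto
      have sub: "{b. \<exists>U. Step U b \<in> I} \<subseteq> g (ded_closure X S)"
      proof clarify
        fix b U assume s: "Step U b \<in> I"
        then have "Step U b \<in> lam X g" using I W by auto
        then have u: "fset U \<subseteq> toks X" "con X (fset U)" "b \<in> g (ded_closure X (fset U))" by (auto simp: lam_def)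
        have "ded_closure X (fset U) \<subseteq> ded_closure X S" using s by (auto simp: ded_closure_def S_def elim!: entails_mono)
        then show "b \<in> g (ded_closure X S)" using scott_cont_mono[OF g ded_closure_Dom[OF u(2,1)] D] u by auto
      qed
      have "finite {b. \<exists>U. Step U b \<in> I}"
        by (rule finite_subset[OF _ finite_imageI[OF fI, of "\<lambda>t. case t of Step U b \<Rightarrow> b"]]) (force simp: image_def)
      then show "con Y {b. \<exists>U. Step U b \<in> I}" using sub g D DomD(1) by (auto simp: scott_cont_def)
    qed
    fix a assume a: "a \<in> toks (X \<rightarrow> Y)" "entails (X \<rightarrow> Y) W a"
    then obtain U b where u: "a = Step U b" "fset U \<subseteq> toks X" "con X (fset U)" "b \<in> toks Y"
      "entails Y {b'. \<exists>U'. Step U' b' \<in> W \<and> (\<forall>a\<in>fset U'. entails X (fset U) a)} b" by auto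
    let ?V = "{b'. \<exists>U'. Step U' b' \<in> W \<and> (\<forall>a\<in>fset U'. entails X (fset U) a)}"
    note D = ded_closure_Dom[OF u(3,2)]
    have "finite ?V"
      by (rule finite_subset[OF _ finite_imageI[OF W(2), of "\<lambda>t. case t of Step U b \<Rightarrow> b"]]) (force simp: image_def)
    moreover have "?V \<subseteq> g (ded_closure X (fset U))"
    proof clarify
      fix b' U' assume s: "Step U' b' \<in> W" "\<forall>a\<in>fset U'. entails X (fset U) a"
      then have "Step U' b' \<in> lam X g" using W by auto
      then have u': "fset U' \<subseteq> toks X" "con X (fset U')" "b' \<in> g (ded_closure X (fset U'))" by (auto simp: lam_def)
      have "ded_closure X (fset U') \<subseteq> ded_closure X (fset U)" using s by (auto simp: ded_closure_def intro: entails_trans)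
      then show "b' \<in> g (ded_closure X (fset U))" using scott_cont_mono[OF g ded_closure_Dom[OF u'(2,1)] D] u' by auto
    qed
    ultimately have "b \<in> g (ded_closure X (fset U))" using gd[OF u(2,3)] u by (auto simp: Dom_def)
    then show "a \<in> lam X g" using u by (auto simp: lam_def)
  qed
qed

lemma lam_app: assumes f: "f \<in> Dom (X \<rightarrow> Y)" shows "lam X (\<lambda>x. f \<bullet> x) = f"
proof (intro set_eqI iffI)
  fix t assume t: "t \<in> f"
  then have "t \<in> toks (X \<rightarrow> Y)" using f by (auto simp: Dom_def)
  then obtain U b where u: "t = Step U b" "fset U \<subseteq> toks X" "con X (fset U)" "b \<in> toks Y" by auto
  have "fset U \<subseteq> ded_closure X (fset U)" using u by (auto simp: ded_closure_def intro: entails_refl)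
  then show "t \<in> lam X (\<lambda>x. f \<bullet> x)" using u t by (auto simp: lam_def app_def)
next
  fix t assume "t \<in> lam X (\<lambda>x. f \<bullet> x)"
  then obtain U U' b where u: "t = Step U b" "fset U \<subseteq> toks X" "con X (fset U)" "Step U' b \<in> f" "fset U' \<subseteq> ded_closure X (fset U)"
    by (auto simp: lam_def app_def)
  have tk: "Step U b \<in> toks (X \<rightarrow> Y)" using u f by (auto simp: Dom_def)
  have "entails (X \<rightarrow> Y) {Step U' b} (Step U b)"
    unfolding entails.simps
    by (intro exI conjI, rule refl, rule entails_refl) (use u tk in \<open>auto simp: ded_closure_def\<close>)
  moreover have "finite {Step U' b}" "{Step U' b} \<subseteq> f" using u by auto
  ultimately show "t \<in> f" using f tk u(1) unfolding Dom_def by blast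
qed

lemma scott_cont_app: assumes f: "f \<in> Dom (X \<rightarrow> Y)" shows "scott_cont X Y (\<lambda>x. f \<bullet> x)"
proof -
  have "f \<bullet> x = (\<Union>W\<in>{W. finite W \<and> W \<subseteq> x}. f \<bullet> ded_closure X W)" if x: "x \<in> Dom X" for x
  proof (intro set_eqI iffI)
    fix b assume "b \<in> f \<bullet> x"
    then obtain U where U: "Step U b \<in> f" "fset U \<subseteq> x" by (auto simp: app_def)
    have "fset U \<subseteq> ded_closure X (fset U)"
      using DomD(2)[OF x U(2)] by (auto simp: ded_closure_def intro: entails_refl)
    then have "b \<in> f \<bullet> ded_closure X (fset U)" using U unfolding app_def by blast
    then show "b \<in> (\<Union>W\<in>{W. finite W \<and> W \<subseteq> x}. f \<bullet> ded_closure X W)"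
      using U by (intro UN_I[of "fset U"]) auto
  next
    fix b assume "b \<in> (\<Union>W\<in>{W. finite W \<and> W \<subseteq> x}. f \<bullet> ded_closure X W)"
    then obtain W U where W: "finite W" "W \<subseteq> x" "Step U b \<in> f" "fset U \<subseteq> ded_closure X W"
      unfolding app_def by blast
    have "ded_closure X W \<subseteq> x" using DomD(3)[OF x W(2,1)] by (auto simp: ded_closure_def)
    with W show "b \<in> f \<bullet> x" unfolding app_def by blast
  qed
  with app_Dom[OF f] show ?thesis unfolding scott_cont_def by blast
qed

lemma app_le_iff:
  assumes f: "f \<in> Dom (X \<rightarrow> Y)" and g: "g \<in> Dom (X \<rightarrow> Y)"
  shows "f \<subseteq> g \<longleftrightarrow> (\<forall>x\<in>Dom X. f \<bullet> x \<subseteq> g \<bullet> x)"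
proof
  show "f \<subseteq> g \<Longrightarrow> \<forall>x\<in>Dom X. f \<bullet> x \<subseteq> g \<bullet> x" unfolding app_def by blast
  assume le: "\<forall>x\<in>Dom X. f \<bullet> x \<subseteq> g \<bullet> x"
  have "lam X (\<lambda>x. f \<bullet> x) \<subseteq> lam X (\<lambda>x. g \<bullet> x)"
    unfolding lam_def using le ded_closure_Dom by blast
  then show "f \<subseteq> g" using lam_app[OF f] lam_app[OF g] by simp
qed


definition truth :: "bool \<Rightarrow> tok set" where
  "truth b = {BoolTok b}"

definition num :: "nat \<Rightarrow> tok set" where
  "num n = {NatTok n}"

definition pair :: "tok set \<Rightarrow> tok set \<Rightarrow> tok set" where
  "pair x y = LeftTok ` x \<union> RightTok ` y"

definition pfst :: "tok set \<Rightarrow> tok set" where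
  "pfst p = {a. LeftTok a \<in> p}"

definition psnd :: "tok set \<Rightarrow> tok set" where
  "psnd p = {b. RightTok b \<in> p}"

definition seq :: "tok set list \<Rightarrow> tok set" where
  "seq xs = insert (Len (length xs)) {Ent (length xs) i a | i a. i < length xs \<and> a \<in> xs ! i}"

text \<open>
  Strict case distinctions: the index set of each union is empty for the bottom element and a
  singleton for every other element of the domain in question.
\<close>

definition bool_case :: "tok set \<Rightarrow> (bool \<Rightarrow> tok set) \<Rightarrow> tok set" where
  "bool_case x g = (\<Union>b\<in>{b. BoolTok b \<in> x}. g b)"

definition nat_case :: "tok set \<Rightarrow> (nat \<Rightarrow> tok set) \<Rightarrow> tok set" where
  "nat_case x g = (\<Union>n\<in>{n. NatTok n \<in> x}. g n)"

definition seq_case :: "tok set \<Rightarrow> (tok set list \<Rightarrow> tok set) \<Rightarrow> tok set" where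
  "seq_case x g = (\<Union>n\<in>{n. Len n \<in> x}. g (map (\<lambda>i. {a. Ent n i a \<in> x}) [0..<n]))"

primrec zero :: "ty \<Rightarrow> tok set" where
  "zero Boolean = truth False"
| "zero Natural = num 0"
| "zero (X \<otimes> Y) = pair (zero X) (zero Y)"
| "zero (Star X) = seq []"
| "zero (X \<rightarrow> Y) = lam X (\<lambda>_. zero Y)"

definition if_else_zero :: "ty \<Rightarrow> tok set \<Rightarrow> tok set \<Rightarrow> tok set" where
  "if_else_zero Y E A = bool_case A (\<lambda>b. if b then E else zero Y)"


section \<open>Total elements and the total continuous functionals\<close>

primrec is_total :: "ty \<Rightarrow> tok set \<Rightarrow> bool" where
  "is_total Boolean x \<longleftrightarrow> x \<in> Dom Boolean \<and> x \<noteq> {}"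
| "is_total Natural x \<longleftrightarrow> x \<in> Dom Natural \<and> x \<noteq> {}"
| "is_total (X \<otimes> Y) x \<longleftrightarrow> x \<in> Dom (X \<otimes> Y) \<and> is_total X (pfst x) \<and> is_total Y (psnd x)"
| "is_total (Star X) x \<longleftrightarrow> x \<in> Dom (Star X) \<and> (\<exists>xs. x = seq xs \<and> (\<forall>y\<in>set xs. is_total X y))"
| "is_total (X \<rightarrow> Y) f \<longleftrightarrow> f \<in> Dom (X \<rightarrow> Y) \<and> (\<forall>x. is_total X x \<longrightarrow> is_total Y (f \<bullet> x))"

primrec exteq :: "ty \<Rightarrow> tok set \<Rightarrow> tok set \<Rightarrow> bool" where
  "exteq Boolean x y \<longleftrightarrow> is_total Boolean x \<and> x = y"
| "exteq Natural x y \<longleftrightarrow> is_total Natural x \<and> x = y"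
| "exteq (X \<otimes> Y) x y \<longleftrightarrow> is_total (X \<otimes> Y) x \<and> is_total (X \<otimes> Y) y \<and>
     exteq X (pfst x) (pfst y) \<and> exteq Y (psnd x) (psnd y)"
| "exteq (Star X) x y \<longleftrightarrow> is_total (Star X) x \<and> is_total (Star X) y \<and>
     (\<exists>xs ys. x = seq xs \<and> y = seq ys \<and> list_all2 (exteq X) xs ys)"
| "exteq (X \<rightarrow> Y) f g \<longleftrightarrow> is_total (X \<rightarrow> Y) f \<and> is_total (X \<rightarrow> Y) g \<and>
     (\<forall>x y. exteq X x y \<longrightarrow> exteq Y (f \<bullet> x) (g \<bullet> y))"

text \<open>The Kleene--Kreisel functionals, as extensional equality classes of total elements.\<close>

definition KK :: "ty \<Rightarrow> tok set set set" where
  "KK X = {x. is_total X x} // {(x, y). exteq X x y}"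

definition cls :: "ty \<Rightarrow> tok set \<Rightarrow> tok set set" where
  "cls X x = {y. exteq X x y}"

definition kapp :: "ty \<Rightarrow> tok set set \<Rightarrow> tok set set \<Rightarrow> tok set set" where
  "kapp Y f x = (\<Union>a\<in>f. \<Union>b\<in>x. cls Y (a \<bullet> b))"

definition kfst :: "ty \<Rightarrow> tok set set \<Rightarrow> tok set set" where
  "kfst X p = (\<Union>a\<in>p. cls X (pfst a))"

definition ksnd :: "ty \<Rightarrow> tok set set \<Rightarrow> tok set set" where
  "ksnd Y p = (\<Union>a\<in>p. cls Y (psnd a))"

abbreviation knth :: "ty \<Rightarrow> tok set set \<Rightarrow> nat \<Rightarrow> tok set set" where
  "knth X u n \<equiv> kapp X u (cls Natural (num n))"

text \<open>Every sequence \<open>g\<close> in \<^term>\<open>KK X\<close> is given by exactly one element of \<^term>\<open>KK (Stream X)\<close>.\<close>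

definition kstream :: "ty \<Rightarrow> (nat \<Rightarrow> tok set set) \<Rightarrow> tok set set" where
  "kstream X g = (THE w. w \<in> KK (Stream X) \<and> (\<forall>n. knth X w n = g n))"


section \<open>System T\<close>

text \<open>Terms use de Bruijn indices.\<close>

datatype tm =
    Var nat
  | Lam ty tm
  | App tm tm
  | BoolConst bool
  | Cond tm tm tm
  | Zero
  | Succ tm
  | NatRec tm tm tm
  | Pair tm tm
  | Fst tm
  | Snd tm
  | EmptySeq
  | ConsSeq tm tm
  | SeqRec tm tm tm

inductive typed :: "ty list \<Rightarrow> tm \<Rightarrow> ty \<Rightarrow> bool"  (\<open>_ \<turnstile> _ : _\<close> [50, 50, 50] 50) where
  "i < length \<Gamma> \<Longrightarrow> \<Gamma> \<turnstile> Var i : \<Gamma> ! i"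
| "X # \<Gamma> \<turnstile> t : Y \<Longrightarrow> \<Gamma> \<turnstile> Lam X t : X \<rightarrow> Y"
| "\<Gamma> \<turnstile> s : X \<rightarrow> Y \<Longrightarrow> \<Gamma> \<turnstile> t : X \<Longrightarrow> \<Gamma> \<turnstile> App s t : Y"
| "\<Gamma> \<turnstile> BoolConst b : Boolean"
| "\<Gamma> \<turnstile> r : Boolean \<Longrightarrow> \<Gamma> \<turnstile> s : X \<Longrightarrow> \<Gamma> \<turnstile> t : X \<Longrightarrow> \<Gamma> \<turnstile> Cond r s t : X"
| "\<Gamma> \<turnstile> Zero : Natural"
| "\<Gamma> \<turnstile> t : Natural \<Longrightarrow> \<Gamma> \<turnstile> Succ t : Natural"
| "\<Gamma> \<turnstile> r : X \<Longrightarrow> \<Gamma> \<turnstile> s : Natural \<rightarrow> X \<rightarrow> X \<Longrightarrow> \<Gamma> \<turnstile> t : Natural \<Longrightarrow> \<Gamma> \<turnstile> NatRec r s t : X"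
| "\<Gamma> \<turnstile> s : X \<Longrightarrow> \<Gamma> \<turnstile> t : Y \<Longrightarrow> \<Gamma> \<turnstile> Pair s t : X \<otimes> Y"
| "\<Gamma> \<turnstile> t : X \<otimes> Y \<Longrightarrow> \<Gamma> \<turnstile> Fst t : X"
| "\<Gamma> \<turnstile> t : X \<otimes> Y \<Longrightarrow> \<Gamma> \<turnstile> Snd t : Y"
| "\<Gamma> \<turnstile> EmptySeq : Star X"
| "\<Gamma> \<turnstile> s : X \<Longrightarrow> \<Gamma> \<turnstile> t : Star X \<Longrightarrow> \<Gamma> \<turnstile> ConsSeq s t : Star X"
| "\<Gamma> \<turnstile> r : Y \<Longrightarrow> \<Gamma> \<turnstile> s : X \<rightarrow> Star X \<rightarrow> Y \<rightarrow> Y \<Longrightarrow> \<Gamma> \<turnstile> t : Star X \<Longrightarrow> \<Gamma> \<turnstile> SeqRec r s t : Y"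

primrec den :: "tm \<Rightarrow> tok set list \<Rightarrow> tok set" where
  "den (Var i) \<rho> = \<rho> ! i"
| "den (Lam X t) \<rho> = lam X (\<lambda>x. den t (x # \<rho>))"
| "den (App s t) \<rho> = den s \<rho> \<bullet> den t \<rho>"
| "den (BoolConst b) \<rho> = truth b"
| "den (Cond r s t) \<rho> = bool_case (den r \<rho>) (\<lambda>b. if b then den s \<rho> else den t \<rho>)"
| "den Zero \<rho> = num 0"
| "den (Succ t) \<rho> = nat_case (den t \<rho>) (\<lambda>n. num (Suc n))"
| "den (NatRec r s t) \<rho> =
     nat_case (den t \<rho>) (rec_nat (den r \<rho>) (\<lambda>n y. den s \<rho> \<bullet> num n \<bullet> y))"
| "den (Pair s t) \<rho> = pair (den s \<rho>) (den t \<rho>)"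
| "den (Fst t) \<rho> = pfst (den t \<rho>)"
| "den (Snd t) \<rho> = psnd (den t \<rho>)"
| "den EmptySeq \<rho> = seq []"
| "den (ConsSeq s t) \<rho> = seq_case (den t \<rho>) (\<lambda>xs. seq (den s \<rho> # xs))"
| "den (SeqRec r s t) \<rho> =
     seq_case (den t \<rho>) (rec_list (den r \<rho>) (\<lambda>x xs y. den s \<rho> \<bullet> x \<bullet> seq xs \<bullet> y))"


section \<open>Primitive recursive wellfounded relations\<close>

text \<open>
  A relation \<open>\<rhd>\<close> on \<open>X\<close> is given by its characteristic function
  \<open>R \<in> Dom (X \<rightarrow> X \<rightarrow> Boolean)\<close>; \<open>below R y x\<close> is the truth value of \<open>x \<rhd> y\<close>, i.e. of \<open>y \<lhd> x\<close>.
\<close>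

definition below :: "tok set \<Rightarrow> tok set \<Rightarrow> tok set \<Rightarrow> tok set" where
  "below R y x = R \<bullet> x \<bullet> y"

definition primrec_relation :: "ty \<Rightarrow> tok set \<Rightarrow> bool" where
  "primrec_relation X R \<longleftrightarrow> (\<exists>t. [] \<turnstile> t : X \<rightarrow> X \<rightarrow> Boolean \<and> R = den t [])"

definition wellfounded_relation :: "ty \<Rightarrow> tok set \<Rightarrow> bool" where
  "wellfounded_relation X R \<longleftrightarrow> wfp_on {x. is_total X x} (\<lambda>y x. below R y x = truth True)"

text \<open>
  For every result type some closed term \<open>t\<close> satisfies, in the total continuous functionals,
  \<open>t G x = G x (\<lambda>y. t G y if y \<lhd> x)\<close>.
\<close>

definition wf_recursion_definable :: "ty \<Rightarrow> tok set \<Rightarrow> bool" where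
  "wf_recursion_definable X R \<longleftrightarrow>
     (\<forall>Y. \<exists>t. [] \<turnstile> t : (X \<rightarrow> (X \<rightarrow> Y) \<rightarrow> Y) \<rightarrow> X \<rightarrow> Y \<and>
        (\<forall>G x. is_total (X \<rightarrow> (X \<rightarrow> Y) \<rightarrow> Y) G \<longrightarrow> is_total X x \<longrightarrow>
           exteq Y (den t [] \<bullet> G \<bullet> x)
             (G \<bullet> x \<bullet> lam X (\<lambda>y. if_else_zero Y (den t [] \<bullet> G \<bullet> y) (below R y x)))))"


section \<open>Explicitly controlled open recursion\<close>

definition initial_seg :: "tok set \<Rightarrow> tok set \<Rightarrow> tok set" where
  "initial_seg u n = nat_case n (\<lambda>n. seq (map (\<lambda>i. u \<bullet> num i) [0..<n]))"

definition append_seq :: "tok set \<Rightarrow> tok set \<Rightarrow> tok set" where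
  "append_seq s v = lam Natural (\<lambda>k. nat_case k (\<lambda>k. seq_case s (\<lambda>xs.
     if k < length xs then xs ! k else v \<bullet> num (k - length xs))))"

definition ext :: "ty \<Rightarrow> tok set \<Rightarrow> nat \<Rightarrow> tok set" where
  "ext Z \<alpha> m = lam Natural (\<lambda>n. nat_case n (\<lambda>n. if n < m then \<alpha> \<bullet> num n else zero Z))"

definition spec :: "ty \<Rightarrow> tok set \<Rightarrow> tok set \<Rightarrow> tok set" where
  "spec Z \<alpha> F = lam Natural (\<lambda>n. nat_case n (\<lambda>n.
     foldr (\<lambda>m E. nat_case (F \<bullet> ext Z \<alpha> m) (\<lambda>k. if k < m then zero Z else E))
       [0..<Suc n] (\<alpha> \<bullet> num n)))"

abbreviation EOR_arg :: "ty \<Rightarrow> ty \<Rightarrow> ty" where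
  "EOR_arg X Y \<equiv> X \<otimes> (Stream X \<rightarrow> Y)"

abbreviation EOR_ty :: "ty \<Rightarrow> ty \<Rightarrow> ty" where
  "EOR_ty X Y \<equiv>
     (Stream (EOR_arg X Y) \<rightarrow> Y) \<rightarrow> (Stream (EOR_arg X Y) \<rightarrow> Natural) \<rightarrow> Stream X \<rightarrow> Y"

definition EOR_seq ::
    "ty \<Rightarrow> ty \<Rightarrow> tok set \<Rightarrow> tok set \<Rightarrow> tok set \<Rightarrow> tok set \<Rightarrow> tok set \<Rightarrow> tok set" where
  "EOR_seq X Y R \<Phi> H F u =
     lam Natural (\<lambda>n. pair (u \<bullet> n)
       (lam (Stream X) (\<lambda>v.
          if_else_zero Y (\<Phi> \<bullet> H \<bullet> F \<bullet> append_seq (initial_seg u n) v) (below R (v \<bullet> num 0) (u \<bullet> n)))))"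

definition EOR_equation :: "ty \<Rightarrow> ty \<Rightarrow> tok set \<Rightarrow> tok set \<Rightarrow> bool" where
  "EOR_equation X Y R \<Phi> \<longleftrightarrow>
     (\<forall>H\<in>Dom (Stream (EOR_arg X Y) \<rightarrow> Y). \<forall>F\<in>Dom (Stream (EOR_arg X Y) \<rightarrow> Natural).
      \<forall>u\<in>Dom (Stream X).
        \<Phi> \<bullet> H \<bullet> F \<bullet> u = H \<bullet> spec (EOR_arg X Y) (EOR_seq X Y R \<Phi> H F u) F)"

definition EOR_least_fixpoint :: "ty \<Rightarrow> ty \<Rightarrow> tok set \<Rightarrow> tok set \<Rightarrow> bool" where
  "EOR_least_fixpoint X Y R \<Phi> \<longleftrightarrow>
     \<Phi> \<in> Dom (EOR_ty X Y) \<and> EOR_equation X Y R \<Phi> \<and>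
     (\<forall>\<Psi>\<in>Dom (EOR_ty X Y). EOR_equation X Y R \<Psi> \<longrightarrow> \<Phi> \<subseteq> \<Psi>)"


section \<open>The defining equation in the total continuous functionals\<close>

definition kbelow :: "ty \<Rightarrow> tok set \<Rightarrow> tok set set \<Rightarrow> tok set set \<Rightarrow> bool" where
  "kbelow X R y x \<longleftrightarrow>
     kapp Boolean (kapp (X \<rightarrow> Boolean) (cls (X \<rightarrow> X \<rightarrow> Boolean) R) x) y = cls Boolean (truth True)"

definition kconcat :: "ty \<Rightarrow> tok set set \<Rightarrow> nat \<Rightarrow> tok set set \<Rightarrow> tok set set" where
  "kconcat X u n v = kstream X (\<lambda>k. if k < n then knth X u k else knth X v (k - n))"

definition kext :: "ty \<Rightarrow> tok set set \<Rightarrow> nat \<Rightarrow> tok set set" where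
  "kext Z \<alpha> m = kstream Z (\<lambda>n. if n < m then knth Z \<alpha> n else cls Z (zero Z))"

definition kspec :: "ty \<Rightarrow> tok set set \<Rightarrow> tok set set \<Rightarrow> tok set set" where
  "kspec Z \<alpha> F = kstream Z (\<lambda>n.
     if \<exists>m\<le>n. \<exists>k<m. kapp Natural F (kext Z \<alpha> m) = cls Natural (num k)
     then cls Z (zero Z) else knth Z \<alpha> n)"

text \<open>By extensionality there is at most one \<open>\<alpha>\<close> as required here.\<close>

definition KK_EOR_equation :: "ty \<Rightarrow> ty \<Rightarrow> tok set \<Rightarrow> tok set set \<Rightarrow> bool" where
  "KK_EOR_equation X Y R \<Phi> \<longleftrightarrow>
     (let Z = EOR_arg X Y;
          eor = (\<lambda>H F u.
            kapp Y (kapp (Stream X \<rightarrow> Y) (kapp ((Stream Z \<rightarrow> Natural) \<rightarrow> Stream X \<rightarrow> Y) \<Phi> H) F) u)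
      in \<forall>H\<in>KK (Stream Z \<rightarrow> Y). \<forall>F\<in>KK (Stream Z \<rightarrow> Natural). \<forall>u\<in>KK (Stream X).
           \<exists>\<alpha>\<in>KK (Stream Z).
             (\<forall>n. kfst X (knth Z \<alpha> n) = knth X u n \<and>
                (\<forall>v\<in>KK (Stream X). kapp Y (ksnd (Stream X \<rightarrow> Y) (knth Z \<alpha> n)) v =
                   (if kbelow X R (knth X v 0) (knth X u n) then eor H F (kconcat X u n v)
                    else cls Y (zero Y)))) \<and>
             eor H F u = kapp Y H (kspec Z \<alpha> F))"

end

theory Submission
  imports Defs
begin

text \<open>
  The right-hand side of the defining equation is continuous in all its arguments, so that the least
  fixpoint is obtained by Kleene's iteration (\<open>kleene_fixpoint\<close>, \<open>EOR_least_fixpoint_exists\<close>).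
  Continuity is checked by rules for the constructs involved; under an abstraction it suffices to
  check it separately in the bound variable and in the parameters (\<open>scott_cont_lam\<close>).

  Totality is a minimal bad sequence argument (\<open>EOR_value_total\<close>). Fix total \<open>H\<close> and \<open>F\<close>, and call a
  total sequence bad if the value of the fixpoint at it is not total. If there are bad sequences,
  choose \<open>w 0, w 1, \<dots>\<close> in turn so that every initial segment has a bad extension and each entry is
  minimal for the wellfounded relation (\<open>minimal_bad_sequence\<close>). By minimality all recursive calls
  made from \<open>w\<close> return total values, so that the sequence \<open>\<alpha>\<close> belonging to \<open>w\<close> is total. Since \<open>F\<close> is
  continuous, its values at the truncations of \<open>\<alpha>\<close> are eventually constant, and some truncation of
  length \<open>m\<close> has a value below \<open>m\<close> (\<open>cutoff_exists\<close>). Then \<open>spec\<close> does not look beyond \<open>m\<close>, hence for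
  every sequence that agrees with \<open>w\<close> before \<open>m\<close> it is total (\<open>spec_total\<close>), and so is the value of
  \<open>H\<close> at it. But one of these sequences is bad.

  To pass to the total continuous functionals it has to be known that total functionals respect
  extensional equality. The reason is that two total elements are extensionally equal exactly if
  their intersection is total (\<open>exteq_iff_total_Int\<close>), which makes reflexivity trivial. All operations
  in the defining equation can then be computed on representatives.

  The relation is total because closed terms of system T denote total elements (\<open>typed_total\<close>).
\<close>

section \<open>The domains of the finite types\<close>

lemma empty_Dom: "{} \<in> Dom X"
  by (auto simp: Dom_def con_empty entails_empty)

lemma DomI:
  assumes "x \<subseteq> toks X"
    and "\<And>W. finite W \<Longrightarrow> W \<subseteq> x \<Longrightarrow> con X W"
    and "\<And>W a. finite W \<Longrightarrow> W \<subseteq> x \<Longrightarrow> a \<in> toks X \<Longrightarrow> entails X W a \<Longrightarrow> a \<in> x"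
  shows "x \<in> Dom X"
  using assms unfolding Dom_def by blast

lemma Dom_toks: "x \<in> Dom X \<Longrightarrow> a \<in> x \<Longrightarrow> a \<in> toks X"
  unfolding Dom_def by blast

lemma ded_closure_le: "x \<in> Dom X \<Longrightarrow> finite W \<Longrightarrow> W \<subseteq> x \<Longrightarrow> ded_closure X W \<subseteq> x"
  using DomD(3) unfolding ded_closure_def by blast

lemma ded_closure_Dom_le: "x \<in> Dom X \<Longrightarrow> finite W \<Longrightarrow> W \<subseteq> x \<Longrightarrow> ded_closure X W \<in> Dom X"
  by (meson DomD(1,2) ded_closure_Dom)

lemma ded_closure_mono: "V \<subseteq> W \<Longrightarrow> ded_closure X V \<subseteq> ded_closure X W"
  using entails_mono unfolding ded_closure_def by blast

lemma subset_ded_closure: "x \<in> Dom X \<Longrightarrow> W \<subseteq> x \<Longrightarrow> W \<subseteq> ded_closure X W"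
  using DomD(2) entails_refl unfolding ded_closure_def by blast

lemma num_Dom: "num n \<in> Dom Natural"
  by (auto simp: Dom_def num_def)

lemma truth_Dom: "truth b \<in> Dom Boolean"
  by (auto simp: Dom_def truth_def)

lemma NatTok_unique:
  assumes "x \<in> Dom Natural" "NatTok m \<in> x" "NatTok n \<in> x" shows "m = n"
proof -
  have "con Natural {NatTok m, NatTok n}" by (rule DomD(1)[OF assms(1)]) (use assms(2,3) in auto)
  from this[unfolded con.simps, THEN bspec, THEN bspec, of "NatTok m" "NatTok n"]
  show ?thesis by simp
qed

lemma BoolTok_unique:
  assumes "x \<in> Dom Boolean" "BoolTok m \<in> x" "BoolTok n \<in> x" shows "m = n"
proof -
  have "con Boolean {BoolTok m, BoolTok n}" by (rule DomD(1)[OF assms(1)]) (use assms(2,3) in auto)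
  from this[unfolded con.simps, THEN bspec, THEN bspec, of "BoolTok m" "BoolTok n"]
  show ?thesis by simp
qed

lemma Dom_Natural_eq_num:
  assumes x: "x \<in> Dom Natural" "NatTok n \<in> x" shows "x = num n"
proof -
  have "t = NatTok n" if t: "t \<in> x" for t
  proof -
    obtain c where c: "t = NatTok c" using Dom_toks[OF x(1) t] by auto
    have "c = n" by (rule NatTok_unique[OF x(1)]) (use t c x(2) in simp_all)
    with c show ?thesis by simp
  qed
  with x(2) show ?thesis unfolding num_def by blast
qed

lemma Dom_Boolean_eq_truth:
  assumes x: "x \<in> Dom Boolean" "BoolTok b \<in> x" shows "x = truth b"
proof -
  have "t = BoolTok b" if t: "t \<in> x" for t
  proof -
    obtain c where c: "t = BoolTok c" using Dom_toks[OF x(1) t] by auto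
    have "c = b" by (rule BoolTok_unique[OF x(1)]) (use t c x(2) in simp_all)
    with c show ?thesis by simp
  qed
  with x(2) show ?thesis unfolding truth_def by blast
qed

lemma pair_Dom:
  assumes x: "x \<in> Dom X" and y: "y \<in> Dom Y" shows "pair x y \<in> Dom (X \<otimes> Y)"
proof (rule DomI)
  show "pair x y \<subseteq> toks (X \<otimes> Y)"
    using x y by (auto simp: pair_def dest: Dom_toks)
  fix W assume W: "finite W" "W \<subseteq> pair x y"
  have l: "finite {a. LeftTok a \<in> W}" "{a. LeftTok a \<in> W} \<subseteq> x"
    using finite_vimageI[OF W(1), of LeftTok] W(2) by (auto simp: vimage_def inj_def pair_def)
  have r: "finite {a. RightTok a \<in> W}" "{a. RightTok a \<in> W} \<subseteq> y"
    using finite_vimageI[OF W(1), of RightTok] W(2) by (auto simp: vimage_def inj_def pair_def)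
  show "con (X \<otimes> Y) W"
    using DomD(1)[OF x l(2,1)] DomD(1)[OF y r(2,1)] by simp
  show "a \<in> pair x y" if "a \<in> toks (X \<otimes> Y)" "entails (X \<otimes> Y) W a" for a
    using that DomD(3)[OF x l(2,1)] DomD(3)[OF y r(2,1)] by (auto simp: pair_def)
qed

lemma pfst_Dom:
  assumes x: "x \<in> Dom (X \<otimes> Y)" shows "pfst x \<in> Dom X"
proof (rule DomI)
  show "pfst x \<subseteq> toks X" using Dom_toks[OF x] by (fastforce simp: pfst_def)
  fix W assume W: "finite W" "W \<subseteq> pfst x"
  have V: "LeftTok ` W \<subseteq> x" "finite (LeftTok ` W)" "{a. LeftTok a \<in> LeftTok ` W} = W"
    using W by (auto simp: pfst_def)
  show "con X W" using DomD(1)[OF x V(1,2)] V(3) by simp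
  show "a \<in> pfst x" if "a \<in> toks X" "entails X W a" for a
    using DomD(3)[OF x V(1,2), of "LeftTok a"] V(3) that by (simp add: pfst_def)
qed

lemma psnd_Dom:
  assumes x: "x \<in> Dom (X \<otimes> Y)" shows "psnd x \<in> Dom Y"
proof (rule DomI)
  show "psnd x \<subseteq> toks Y" using Dom_toks[OF x] by (fastforce simp: psnd_def)
  fix W assume W: "finite W" "W \<subseteq> psnd x"
  have V: "RightTok ` W \<subseteq> x" "finite (RightTok ` W)" "{a. RightTok a \<in> RightTok ` W} = W"
    using W by (auto simp: psnd_def)
  show "con Y W" using DomD(1)[OF x V(1,2)] V(3) by simp
  show "a \<in> psnd x" if "a \<in> toks Y" "entails Y W a" for a
    using DomD(3)[OF x V(1,2), of "RightTok a"] V(3) that by (simp add: psnd_def)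
qed

lemma pfst_pair [simp]: "pfst (pair x y) = x"
  by (auto simp: pfst_def pair_def)

lemma psnd_pair [simp]: "psnd (pair x y) = y"
  by (auto simp: psnd_def pair_def)

lemma Len_unique:
  assumes "x \<in> Dom (Star X)" "Len m \<in> x" "Len n \<in> x" shows "m = n"
proof -
  have "con (Star X) {Len m, Len n}" by (rule DomD(1)[OF assms(1)]) (use assms(2,3) in auto)
  then show ?thesis by simp
qed

lemma entry_Dom:
  assumes x: "x \<in> Dom (Star X)" shows "{a. Ent n i a \<in> x} \<in> Dom X"
proof (rule DomI)
  show "{a. Ent n i a \<in> x} \<subseteq> toks X" using Dom_toks[OF x] by fastforce
  fix W assume W: "finite W" "W \<subseteq> {a. Ent n i a \<in> x}"
  have V: "Ent n i ` W \<subseteq> x" "finite (Ent n i ` W)" "{a. Ent n i a \<in> Ent n i ` W} = W"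
    using W by auto
  show "con X W"
  proof (cases "W = {}")
    case True
    then show ?thesis by (simp add: con_empty)
  next
    case False
    obtain k where k: "\<forall>t\<in>Ent n i ` W. t = Len k \<or> (\<exists>i a. t = Ent k i a)"
        "\<forall>j. con X {a. Ent k j a \<in> Ent n i ` W}"
      using DomD(1)[OF x V(1,2)] by (simp only: con.simps) blast
    from False k(1) have "k = n" by auto
    with k(2) V(3) show ?thesis by metis
  qed
  show "a \<in> {a. Ent n i a \<in> x}" if a: "a \<in> toks X" "entails X W a" for a
  proof -
    from a(2) obtain c where "c \<in> W" using entails_empty by fastforce
    then have "i < n" using W(2) Dom_toks[OF x] by fastforce
    then show ?thesis
      using DomD(3)[OF x V(1,2), of "Ent n i a"] V(3) a by simp
  qed
qed

lemma seq_Dom: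
  assumes xs: "\<And>x. x \<in> set xs \<Longrightarrow> x \<in> Dom X" shows "seq xs \<in> Dom (Star X)"
proof (rule DomI)
  have nth: "xs ! i \<in> Dom X" if "i < length xs" for i using xs that by simp
  show "seq xs \<subseteq> toks (Star X)"
    using Dom_toks[OF nth] by (auto simp: seq_def)
  fix W assume W: "finite W" "W \<subseteq> seq xs"
  have e: "{a. Ent n i a \<in> W} \<subseteq> (if n = length xs \<and> i < n then xs ! i else {})" for n i
    using W(2) by (auto simp: seq_def)
  have f: "finite {a. Ent n i a \<in> W}" for n i
    using finite_vimageI[OF W(1), of "Ent n i"] by (simp add: vimage_def inj_def)
  have c: "con X {a. Ent n i a \<in> W}" for n i
    using e[of n i] f[of n i] DomD(1)[OF nth, of i "{a. Ent n i a \<in> W}"]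
    by (auto simp: con_empty split: if_splits)
  then show "con (Star X) W"
    using W(2) unfolding con.simps by (intro exI[of _ "length xs"]) (auto simp: seq_def)
  show "t \<in> seq xs" if t: "t \<in> toks (Star X)" "entails (Star X) W t" for t
  proof -
    from t(2) consider (len) n where "t = Len n" "Len n \<in> W \<or> (\<exists>i a. Ent n i a \<in> W)"
      | (ent) n i a where "t = Ent n i a" "entails X {a. Ent n i a \<in> W} a" by auto
    then show ?thesis
    proof cases
      case len
      then show ?thesis using W(2) by (auto simp: seq_def)
    next
      case ent
      then have "{a. Ent n i a \<in> W} \<noteq> {}" using entails_empty by metis
      then have ni: "n = length xs" "i < n" using e[of n i] by (auto split: if_splits)
      have "a \<in> xs ! i"
        using DomD(3)[OF nth _ f ent(2), of i] e[of n i] ni t(1) ent(1) by auto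
      then show ?thesis using ent(1) ni by (simp add: seq_def)
    qed
  qed
qed


section \<open>Continuous functions\<close>

lemma scott_contI:
  assumes "\<And>x. x \<in> Dom X \<Longrightarrow> g x \<in> Dom Y"
    and mono: "\<And>x y. x \<in> Dom X \<Longrightarrow> y \<in> Dom X \<Longrightarrow> x \<subseteq> y \<Longrightarrow> g x \<subseteq> g y"
    and "\<And>x b. x \<in> Dom X \<Longrightarrow> b \<in> g x \<Longrightarrow> \<exists>W. finite W \<and> W \<subseteq> x \<and> b \<in> g (ded_closure X W)"
  shows "scott_cont X Y g"
proof -
  have "g (ded_closure X W) \<subseteq> g x" if "x \<in> Dom X" "finite W" "W \<subseteq> x" for x W
    using that by (intro mono ded_closure_le ded_closure_Dom_le)
  then show ?thesis unfolding scott_cont_def using assms(1,3) by (fastforce simp: set_eq_iff)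
qed

lemma scott_cont_Dom: "scott_cont X Y g \<Longrightarrow> x \<in> Dom X \<Longrightarrow> g x \<in> Dom Y"
  unfolding scott_cont_def by blast

lemma scott_cont_finite_support:
  assumes g: "scott_cont X Y g" and x: "x \<in> Dom X" and V: "finite V" "V \<subseteq> g x"
  obtains W where "finite W" "W \<subseteq> x" "V \<subseteq> g (ded_closure X W)"
proof -
  have "\<exists>W. finite W \<and> W \<subseteq> x \<and> V \<subseteq> g (ded_closure X W)" using V
  proof (induction V rule: finite_induct)
    case empty
    then show ?case by (intro exI[of _ "{}"]) auto
  next
    case (insert b V)
    then obtain W where W: "finite W" "W \<subseteq> x" "V \<subseteq> g (ded_closure X W)" by auto
    have "b \<in> (\<Union>W\<in>{W. finite W \<and> W \<subseteq> x}. g (ded_closure X W))"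
      using insert.prems g x unfolding scott_cont_def by blast
    then obtain W' where W': "finite W'" "W' \<subseteq> x" "b \<in> g (ded_closure X W')" by auto
    let ?U = "W \<union> W'"
    have D: "ded_closure X W \<in> Dom X" "ded_closure X W' \<in> Dom X" "ded_closure X ?U \<in> Dom X"
      using W W' by (auto intro!: ded_closure_Dom_le[OF x])
    have "g (ded_closure X W) \<subseteq> g (ded_closure X ?U)" "g (ded_closure X W') \<subseteq> g (ded_closure X ?U)"
      by (rule scott_cont_mono[OF g D(1,3) ded_closure_mono] scott_cont_mono[OF g D(2,3) ded_closure_mono], blast)+
    then have "insert b V \<subseteq> g (ded_closure X ?U)" using W(3) W'(3) by blast
    with W W' show ?case by (intro exI[of _ ?U]) blast
  qed
  with that show thesis by blast
qed

lemma scott_cont_const: "c \<in> Dom Y \<Longrightarrow> scott_cont X Y (\<lambda>_. c)"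
  by (rule scott_contI) (auto intro: exI[of _ "{}"])

lemma scott_cont_id: "scott_cont X X (\<lambda>x. x)"
proof (rule scott_contI)
  fix x b assume "x \<in> Dom X" "b \<in> x"
  then show "\<exists>W. finite W \<and> W \<subseteq> x \<and> b \<in> ded_closure X W"
    using subset_ded_closure[of x X "{b}"] by (intro exI[of _ "{b}"]) auto
qed

text \<open>
  Application and pairing are continuous for the same reason: each token of the value stems from
  finitely many tokens of the two arguments.
\<close>

lemma scott_cont_binary:
  assumes f: "scott_cont A X f" and g: "scott_cont A Y g"
    and Dom: "\<And>x y. x \<in> Dom X \<Longrightarrow> y \<in> Dom Y \<Longrightarrow> h x y \<in> Dom Z"
    and mono: "\<And>x x' y y'. x \<subseteq> x' \<Longrightarrow> y \<subseteq> y' \<Longrightarrow> h x y \<subseteq> h x' y'"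
    and fin: "\<And>x y b. b \<in> h x y \<Longrightarrow>
      \<exists>V W. finite V \<and> V \<subseteq> x \<and> finite W \<and> W \<subseteq> y \<and> b \<in> h V W"
  shows "scott_cont A Z (\<lambda>a. h (f a) (g a))"
proof (rule scott_contI)
  fix a assume "a \<in> Dom A"
  then show "h (f a) (g a) \<in> Dom Z" using f g Dom scott_cont_Dom by blast
next
  fix a a' assume "a \<in> Dom A" "a' \<in> Dom A" "a \<subseteq> a'"
  then show "h (f a) (g a) \<subseteq> h (f a') (g a')" using scott_cont_mono f g mono by meson
next
  fix a b assume a: "a \<in> Dom A" and b: "b \<in> h (f a) (g a)"
  from fin[OF b] obtain V W where
    VW: "finite V" "V \<subseteq> f a" "finite W" "W \<subseteq> g a" "b \<in> h V W" by blast
  obtain S where S: "finite S" "S \<subseteq> a" "V \<subseteq> f (ded_closure A S)"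
    using scott_cont_finite_support[OF f a] VW by metis
  obtain T where T: "finite T" "T \<subseteq> a" "W \<subseteq> g (ded_closure A T)"
    using scott_cont_finite_support[OF g a] VW by metis
  have "ded_closure A U \<in> Dom A" if "U \<in> {S, T, S \<union> T}" for U
    using that S T by (intro ded_closure_Dom_le[OF a]) auto
  then have "V \<subseteq> f (ded_closure A (S \<union> T))" "W \<subseteq> g (ded_closure A (S \<union> T))"
    using S(3) T(3) scott_cont_mono[OF f, of "ded_closure A S" "ded_closure A (S \<union> T)"]
      scott_cont_mono[OF g, of "ded_closure A T" "ded_closure A (S \<union> T)"]
      ded_closure_mono[of S "S \<union> T" A] ded_closure_mono[of T "S \<union> T" A]
    by auto
  then have "b \<in> h (f (ded_closure A (S \<union> T))) (g (ded_closure A (S \<union> T)))"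
    using mono VW(5) by blast
  then show "\<exists>W. finite W \<and> W \<subseteq> a \<and> b \<in> h (f (ded_closure A W)) (g (ded_closure A W))"
    using S T by (intro exI[of _ "S \<union> T"]) auto
qed

lemma scott_cont_app_app:
  assumes "scott_cont A (X \<rightarrow> Y) f" "scott_cont A X g"
  shows "scott_cont A Y (\<lambda>a. f a \<bullet> g a)"
proof (rule scott_cont_binary[OF assms app_Dom])
  fix x y b assume "b \<in> x \<bullet> y"
  then obtain U where "Step U b \<in> x" "fset U \<subseteq> y" by (auto simp: app_def)
  then show "\<exists>V W. finite V \<and> V \<subseteq> x \<and> finite W \<and> W \<subseteq> y \<and> b \<in> V \<bullet> W"
    by (intro exI[of _ "{Step U b}"] exI[of _ "fset U"]) (auto simp: app_def)
qed (auto simp: app_def)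

lemma scott_cont_pair:
  assumes "scott_cont A X f" "scott_cont A Y g"
  shows "scott_cont A (X \<otimes> Y) (\<lambda>a. pair (f a) (g a))"
proof (rule scott_cont_binary[OF assms pair_Dom])
  fix x y b assume "b \<in> pair x y"
  then consider c where "b = LeftTok c" "c \<in> x" | c where "b = RightTok c" "c \<in> y"
    by (auto simp: pair_def)
  then show "\<exists>V W. finite V \<and> V \<subseteq> x \<and> finite W \<and> W \<subseteq> y \<and> b \<in> pair V W"
  proof cases
    case 1
    then show ?thesis by (intro exI[of _ "{c}"] exI[of _ "{}"]) (auto simp: pair_def)
  next
    case 2
    then show ?thesis by (intro exI[of _ "{c}"] exI[of _ "{}"] exI[of _ "{c}"]) (auto simp: pair_def)
  qed
qed (auto simp: pair_def)

text \<open>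
  A destructor reads off its value token by token, so that a single token of the argument supports
  each token of the value. This covers both projections and the entries of a sequence.
\<close>

lemma scott_cont_tokens:
  assumes f: "scott_cont A X f" and Dom: "\<And>x. x \<in> Dom X \<Longrightarrow> {b. tk b \<in> x} \<in> Dom Y"
  shows "scott_cont A Y (\<lambda>a. {b. tk b \<in> f a})"
proof -
  have "\<exists>V W. finite V \<and> V \<subseteq> x \<and> finite W \<and> W \<subseteq> y \<and> b \<in> {b. tk b \<in> V}"
    if "b \<in> {b. tk b \<in> x}" for x y :: "tok set" and b
    using that by (intro exI[of _ "{tk b}"] exI[of _ "{}"]) auto
  then show ?thesis
    using scott_cont_binary[OF f f, of "\<lambda>x _. {b. tk b \<in> x}" Y] Dom by blast
qed

lemma scott_cont_pfst: "scott_cont A (X \<otimes> Y) f \<Longrightarrow> scott_cont A X (\<lambda>a. pfst (f a))"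
  unfolding pfst_def by (rule scott_cont_tokens) (auto dest: pfst_Dom simp: pfst_def)

lemma scott_cont_psnd: "scott_cont A (X \<otimes> Y) f \<Longrightarrow> scott_cont A Y (\<lambda>a. psnd (f a))"
  unfolding psnd_def by (rule scott_cont_tokens) (auto dest: psnd_Dom simp: psnd_def)

lemma scott_cont_entry: "scott_cont A (Star X) f \<Longrightarrow> scott_cont A X (\<lambda>a. {b. Ent n i b \<in> f a})"
  by (rule scott_cont_tokens[OF _ entry_Dom])

text \<open>
  Separate continuity suffices under \<^const>\<open>lam\<close>, since the tokens of an abstraction are the values
  of its body at compact arguments.
\<close>

lemma scott_cont_lam:
  assumes outer: "\<And>b. b \<in> Dom B \<Longrightarrow> scott_cont A C (\<lambda>a. g a b)"
    and inner: "\<And>a. a \<in> Dom A \<Longrightarrow> scott_cont B C (g a)"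
  shows "scott_cont A (B \<rightarrow> C) (\<lambda>a. lam B (g a))"
proof (rule scott_contI)
  fix a assume "a \<in> Dom A"
  then show "lam B (g a) \<in> Dom (B \<rightarrow> C)" by (intro lam_Dom inner)
next
  fix a a' assume "a \<in> Dom A" "a' \<in> Dom A" "a \<subseteq> a'"
  then have "g a b \<subseteq> g a' b" if "b \<in> Dom B" for b using outer[OF that] scott_cont_mono by blast
  then show "lam B (g a) \<subseteq> lam B (g a')" using ded_closure_Dom unfolding lam_def by blast
next
  fix a t assume a: "a \<in> Dom A" and "t \<in> lam B (g a)"
  then obtain U b where t: "t = Step U b" "fset U \<subseteq> toks B" "con B (fset U)"
      "b \<in> g a (ded_closure B (fset U))" by (auto simp: lam_def)
  obtain W where "finite W" "W \<subseteq> a" "{b} \<subseteq> g (ded_closure A W) (ded_closure B (fset U))"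
    by (rule scott_cont_finite_support[OF outer[OF ded_closure_Dom[OF t(3,2)]] a, of "{b}"])
      (use t in auto)
  then show "\<exists>W. finite W \<and> W \<subseteq> a \<and> t \<in> lam B (g (ded_closure A W))"
    using t by (intro exI[of _ W]) (auto simp: lam_def)
qed

text \<open>
  The index set below has at most one element because two distinct constructor tokens \<open>tk m\<close> and
  \<open>tk n\<close> are inconsistent; hence the union stays in the domain.
\<close>

lemma scott_cont_case:
  assumes f: "scott_cont A X f" and g: "\<And>n. scott_cont A Y (g n)"
    and unique: "\<And>x m n. x \<in> Dom X \<Longrightarrow> tk m \<in> x \<Longrightarrow> tk n \<in> x \<Longrightarrow> m = n"
  shows "scott_cont A Y (\<lambda>a. \<Union>n\<in>{n. tk n \<in> f a}. g n a)"
proof (rule scott_contI)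
  fix a assume a: "a \<in> Dom A"
  show "(\<Union>n\<in>{n. tk n \<in> f a}. g n a) \<in> Dom Y"
  proof (cases "\<exists>n. tk n \<in> f a")
    case True
    then obtain n where "tk n \<in> f a" by blast
    then have "{n. tk n \<in> f a} = {n}" using unique scott_cont_Dom[OF f a] by blast
    then show ?thesis using scott_cont_Dom[OF g a] by simp
  qed (simp add: empty_Dom)
next
  fix a a' assume a: "a \<in> Dom A" "a' \<in> Dom A" "a \<subseteq> a'"
  show "(\<Union>n\<in>{n. tk n \<in> f a}. g n a) \<subseteq> (\<Union>n\<in>{n. tk n \<in> f a'}. g n a')"
    using scott_cont_mono[OF f a] scott_cont_mono[OF g a] by blast
next
  fix a b assume a: "a \<in> Dom A" and "b \<in> (\<Union>n\<in>{n. tk n \<in> f a}. g n a)"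
  then obtain n where n: "tk n \<in> f a" "b \<in> g n a" by blast
  obtain W1 where W1: "finite W1" "W1 \<subseteq> a" "{tk n} \<subseteq> f (ded_closure A W1)"
    by (rule scott_cont_finite_support[OF f a, of "{tk n}"]) (use n in auto)
  obtain W2 where W2: "finite W2" "W2 \<subseteq> a" "{b} \<subseteq> g n (ded_closure A W2)"
    by (rule scott_cont_finite_support[OF g a, of "{b}"]) (use n in auto)
  let ?W = "W1 \<union> W2"
  have D: "ded_closure A W1 \<in> Dom A" "ded_closure A W2 \<in> Dom A" "ded_closure A ?W \<in> Dom A"
    using W1 W2 by (auto intro!: ded_closure_Dom_le[OF a])
  have "tk n \<in> f (ded_closure A ?W)" "b \<in> g n (ded_closure A ?W)"
    using scott_cont_mono[OF f D(1,3) ded_closure_mono] scott_cont_mono[OF g D(2,3) ded_closure_mono]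
      W1 W2 by blast+
  then show "\<exists>W. finite W \<and> W \<subseteq> a \<and> b \<in> (\<Union>n\<in>{n. tk n \<in> f (ded_closure A W)}. g n (ded_closure A W))"
    using W1 W2 by (intro exI[of _ ?W]) auto
qed

lemma scott_cont_nat_case:
  assumes "scott_cont A Natural f" "\<And>n. scott_cont A Y (\<lambda>a. g a n)"
  shows "scott_cont A Y (\<lambda>a. nat_case (f a) (g a))"
  unfolding nat_case_def
  by (rule scott_cont_case[OF assms(1)]) (rule assms(2), rule NatTok_unique)

lemma scott_cont_bool_case:
  assumes "scott_cont A Boolean f" "\<And>b. scott_cont A Y (\<lambda>a. g a b)"
  shows "scott_cont A Y (\<lambda>a. bool_case (f a) (g a))"
  unfolding bool_case_def
  by (rule scott_cont_case[OF assms(1)]) (rule assms(2), rule BoolTok_unique)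

text \<open>
  The length of a defined sequence is fixed, so its entries are a list of separately continuous
  functions \<open>hs\<close>, and the body of the case distinction need only be continuous for those.
\<close>

lemma scott_cont_seq_case:
  assumes f: "scott_cont A (Star X) f"
    and g: "\<And>hs. (\<And>h. h \<in> set hs \<Longrightarrow> scott_cont A X h) \<Longrightarrow> scott_cont A Y (\<lambda>a. g a (map (\<lambda>h. h a) hs))"
  shows "scott_cont A Y (\<lambda>a. seq_case (f a) (g a))"
  unfolding seq_case_def
proof (rule scott_cont_case[OF f])
  fix n
  have "scott_cont A Y (\<lambda>a. g a (map (\<lambda>h. h a) (map (\<lambda>i a. {b. Ent n i b \<in> f a}) [0..<n])))"
    by (rule g) (auto intro: scott_cont_entry[OF f])
  then show "scott_cont A Y (\<lambda>a. g a (map (\<lambda>i. {b. Ent n i b \<in> f a}) [0..<n]))"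
    by (simp add: comp_def)
qed (rule Len_unique)

lemma scott_cont_seq:
  assumes hs: "\<And>h. h \<in> set hs \<Longrightarrow> scott_cont A X h"
  shows "scott_cont A (Star X) (\<lambda>a. seq (map (\<lambda>h. h a) hs))"
proof (rule scott_contI)
  fix a assume "a \<in> Dom A"
  then have "h a \<in> Dom X" if "h \<in> set hs" for h using scott_cont_Dom[OF hs[OF that]] by blast
  then show "seq (map (\<lambda>h. h a) hs) \<in> Dom (Star X)" by (auto intro!: seq_Dom)
next
  fix a a' assume a: "a \<in> Dom A" "a' \<in> Dom A" "a \<subseteq> a'"
  have "(hs ! i) a \<subseteq> (hs ! i) a'" if "i < length hs" for i using scott_cont_mono[OF hs a] that by simp
  then show "seq (map (\<lambda>h. h a) hs) \<subseteq> seq (map (\<lambda>h. h a') hs)" by (fastforce simp: seq_def)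
next
  fix a b assume a: "a \<in> Dom A" and b: "b \<in> seq (map (\<lambda>h. h a) hs)"
  then consider "b = Len (length hs)"
    | i c where "b = Ent (length hs) i c" "i < length hs" "c \<in> (hs ! i) a" by (auto simp: seq_def)
  then show "\<exists>W. finite W \<and> W \<subseteq> a \<and> b \<in> seq (map (\<lambda>h. h (ded_closure A W)) hs)"
  proof cases
    case 1
    then show ?thesis by (intro exI[of _ "{}"]) (auto simp: seq_def)
  next
    case 2
    have c: "scott_cont A X (hs ! i)" by (rule hs) (use 2 in simp)
    obtain W where "finite W" "W \<subseteq> a" "{c} \<subseteq> (hs ! i) (ded_closure A W)"
      by (rule scott_cont_finite_support[OF c a, of "{c}"]) (use 2 in auto)
    then show ?thesis using 2 by (intro exI[of _ W]) (auto simp: seq_def)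
  qed
qed

lemma scott_cont_if:
  assumes "b \<Longrightarrow> scott_cont A Y f" "\<not> b \<Longrightarrow> scott_cont A Y g"
  shows "scott_cont A Y (\<lambda>a. if b then f a else g a)"
  using assms by (cases b) auto


section \<open>Total elements\<close>

declare is_total.simps [simp del] exteq.simps [simp del]

lemma total_Dom: "is_total X x \<Longrightarrow> x \<in> Dom X"
  by (cases X) (auto simp: is_total.simps)

lemma total_num [simp]: "is_total Natural (num n)"
  by (simp only: is_total.simps num_Dom) (simp add: num_def)

lemma total_truth [simp]: "is_total Boolean (truth b)"
  by (simp only: is_total.simps truth_Dom) (simp add: truth_def)

lemma total_NaturalE:
  assumes "is_total Natural x" obtains n where "x = num n"
proof -
  from assms obtain t where x: "x \<in> Dom Natural" and t: "t \<in> x" by (auto simp: is_total.simps)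
  moreover obtain n where "t = NatTok n" using Dom_toks[OF x t] by auto
  ultimately show thesis using Dom_Natural_eq_num that by blast
qed

lemma total_BooleanE:
  assumes "is_total Boolean x" obtains b where "x = truth b"
proof -
  from assms obtain t where x: "x \<in> Dom Boolean" and t: "t \<in> x" by (auto simp: is_total.simps)
  moreover obtain b where "t = BoolTok b" using Dom_toks[OF x t] by auto
  ultimately show thesis using Dom_Boolean_eq_truth that by blast
qed

lemma num_inject [simp]: "num m = num n \<longleftrightarrow> m = n"
  by (auto simp: num_def)

lemma truth_inject [simp]: "truth a = truth b \<longleftrightarrow> a = b"
  by (auto simp: truth_def)

lemma nat_case_num [simp]: "nat_case (num n) g = g n"
  by (simp add: nat_case_def num_def)

lemma bool_case_truth [simp]: "bool_case (truth b) g = g b"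
  by (simp add: bool_case_def truth_def)

lemma entry_seq: "{a. Ent (length xs) i a \<in> seq xs} = (if i < length xs then xs ! i else {})"
  by (auto simp: seq_def)

lemma Len_seq [simp]: "Len n \<in> seq xs \<longleftrightarrow> n = length xs"
  by (auto simp: seq_def)

lemma seq_case_seq [simp]: "seq_case (seq xs) g = g xs"
proof -
  have "map (\<lambda>i. {a. Ent (length xs) i a \<in> seq xs}) [0..<length xs] = map ((!) xs) [0..<length xs]"
    by (intro map_cong) (auto simp: entry_seq)
  also have "\<dots> = xs" by (rule map_nth)
  finally show ?thesis by (simp add: seq_case_def)
qed

lemma seq_inject:
  assumes e: "seq xs = seq ys" shows "xs = ys"
proof (rule nth_equalityI)
  show len: "length xs = length ys" using Len_seq[of "length xs" xs] Len_seq[of "length xs" ys] e by simp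
  show "xs ! i = ys ! i" if "i < length xs" for i
    using entry_seq[of xs i] entry_seq[of ys i] that len e by simp
qed

lemma Dom_Star_eq_seq:
  assumes x: "x \<in> Dom (Star X)" and n: "Len n \<in> x"
  shows "x = seq (map (\<lambda>i. {a. Ent n i a \<in> x}) [0..<n])"
proof -
  have len: "m = n" if "Len m \<in> x" for m using Len_unique[OF x that n] .
  have ent: "m = n \<and> i < n" if t: "Ent m i a \<in> x" for m i a
  proof -
    have "entails (Star X) {Ent m i a} (Len m)" by auto
    then have "Len m \<in> x" using DomD(3)[OF x, of "{Ent m i a}" "Len m"] t by simp
    then show ?thesis using len Dom_toks[OF x t] by auto
  qed
  have tok: "(\<exists>m. t = Len m) \<or> (\<exists>m i a. t = Ent m i a)" if "t \<in> x" for t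
    using Dom_toks[OF x that] by auto
  show ?thesis
  proof (intro set_eqI iffI)
    fix t assume t: "t \<in> x"
    with tok consider m where "t = Len m" | m i a where "t = Ent m i a" by blast
    then show "t \<in> seq (map (\<lambda>i. {a. Ent n i a \<in> x}) [0..<n])"
    proof cases
      case 1
      then show ?thesis using len t by (simp add: seq_def)
    next
      case 2
      then show ?thesis using ent[of m i a] t by (simp add: seq_def)
    qed
  next
    fix t assume "t \<in> seq (map (\<lambda>i. {a. Ent n i a \<in> x}) [0..<n])"
    then show "t \<in> x" using n by (auto simp: seq_def)
  qed
qed

lemma total_pair: "is_total X x \<Longrightarrow> is_total Y y \<Longrightarrow> is_total (X \<otimes> Y) (pair x y)"
  by (simp add: is_total.simps pair_Dom total_Dom)

lemma total_seq: "(\<And>x. x \<in> set xs \<Longrightarrow> is_total X x) \<Longrightarrow> is_total (Star X) (seq xs)"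
  using seq_Dom[of xs X] total_Dom by (auto simp: is_total.simps)

lemma total_app: "is_total (X \<rightarrow> Y) f \<Longrightarrow> is_total X x \<Longrightarrow> is_total Y (f \<bullet> x)"
  by (simp add: is_total.simps)

lemma total_pfst: "is_total (X \<otimes> Y) p \<Longrightarrow> is_total X (pfst p)"
  by (simp add: is_total.simps)

lemma total_psnd: "is_total (X \<otimes> Y) p \<Longrightarrow> is_total Y (psnd p)"
  by (simp add: is_total.simps)

lemma total_functionI:
  "f \<in> Dom (X \<rightarrow> Y) \<Longrightarrow> (\<And>x. is_total X x \<Longrightarrow> is_total Y (f \<bullet> x)) \<Longrightarrow> is_total (X \<rightarrow> Y) f"
  by (simp add: is_total.simps)

lemma total_lam:
  assumes "scott_cont X Y g" "\<And>x. is_total X x \<Longrightarrow> is_total Y (g x)"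
  shows "is_total (X \<rightarrow> Y) (lam X g)"
  using assms by (simp add: is_total.simps lam_Dom app_lam total_Dom)

lemma total_zero: "is_total X (zero X)"
  by (induction X) (auto intro!: total_pair total_seq total_lam scott_cont_const dest: total_Dom)

lemmas zero_Dom = total_zero[THEN total_Dom]

text \<open>
  At function types this is monotonicity of application in the function; at sequence types, a defined
  length is shared by all larger elements, so that only the entries can grow.
\<close>

lemma total_upward: "is_total X x \<Longrightarrow> y \<in> Dom X \<Longrightarrow> x \<subseteq> y \<Longrightarrow> is_total X y"
proof (induction X arbitrary: x y)
  case (Times X Y)
  from Times.prems(1) have t: "is_total X (pfst x)" "is_total Y (psnd x)" by (auto simp: is_total.simps)
  have "is_total X (pfst y)"
    by (rule Times.IH(1)[OF t(1) pfst_Dom[OF Times.prems(2)]]) (use Times.prems(3) in \<open>auto simp: pfst_def\<close>)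
  moreover have "is_total Y (psnd y)"
    by (rule Times.IH(2)[OF t(2) psnd_Dom[OF Times.prems(2)]]) (use Times.prems(3) in \<open>auto simp: psnd_def\<close>)
  ultimately show ?case using Times.prems(2) by (simp add: is_total.simps)
next
  case (Star X)
  then obtain xs where xs: "x = seq xs" "\<And>z. z \<in> set xs \<Longrightarrow> is_total X z" by (auto simp: is_total.simps)
  let ?n = "length xs"
  have "Len ?n \<in> y" using xs(1) Star.prems(3) Len_seq by blast
  then have y: "y = seq (map (\<lambda>i. {a. Ent ?n i a \<in> y}) [0..<?n])"
    by (rule Dom_Star_eq_seq[OF Star.prems(2)])
  have "is_total X {a. Ent ?n i a \<in> y}" if i: "i < ?n" for i
  proof (rule Star.IH[OF xs(2) entry_Dom[OF Star.prems(2)]])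
    show "xs ! i \<in> set xs" using i by simp
    show "xs ! i \<subseteq> {a. Ent ?n i a \<in> y}" using entry_seq[of xs i] i Star.prems(3) xs(1) by auto
  qed
  then show ?case by (subst y) (auto intro!: total_seq)
next
  case (Arrow X Y)
  show ?case unfolding is_total.simps
  proof (intro conjI allI impI)
    fix z assume z: "is_total X z"
    have "x \<bullet> z \<subseteq> y \<bullet> z" using Arrow.prems(3) by (auto simp: app_def)
    then show "is_total Y (y \<bullet> z)"
      using Arrow.IH(2)[OF total_app[OF Arrow.prems(1) z] app_Dom[OF Arrow.prems(2) total_Dom[OF z]]]
      by blast
  qed (rule Arrow.prems(2))
qed (auto simp: is_total.simps)


section \<open>Extensional equality\<close>

lemma Int_Dom:
  assumes x: "x \<in> Dom X" and y: "y \<in> Dom X" shows "x \<inter> y \<in> Dom X"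
proof (rule DomI)
  show "x \<inter> y \<subseteq> toks X" using Dom_toks[OF x] by blast
  fix W assume W: "finite W" "W \<subseteq> x \<inter> y"
  then show "con X W" using DomD(1)[OF x _ W(1)] by simp
  show "a \<in> x \<inter> y" if "a \<in> toks X" "entails X W a" for a
    using DomD(3)[OF x _ W(1) that(2,1)] DomD(3)[OF y _ W(1) that(2,1)] W(2) by simp
qed

text \<open>
  A step with a larger condition is entailed; this lets two functions agree on a common condition
  whenever they produce the same token from different parts of the argument.
\<close>

lemma Step_weaken:
  assumes f: "f \<in> Dom (X \<rightarrow> Y)" and U: "Step U b \<in> f" "fset U \<subseteq> fset V"
    and V: "fset V \<subseteq> toks X" "con X (fset V)"
  shows "Step V b \<in> f"
proof -
  have b: "b \<in> toks Y" using Dom_toks[OF f U(1)] by simp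
  have "entails Y {b'. \<exists>U'. Step U' b' \<in> {Step U b} \<and> (\<forall>a\<in>fset U'. entails X (fset V) a)} b"
    by (rule entails_refl[OF _ b]) (use U(2) V(1) in \<open>auto intro!: entails_refl\<close>)
  then have "entails (X \<rightarrow> Y) {Step U b} (Step V b)" by simp
  then show ?thesis using DomD(3)[OF f, of "{Step U b}" "Step V b"] U(1) V b by simp
qed

lemma app_Int:
  assumes f: "f \<in> Dom (X \<rightarrow> Y)" and g: "g \<in> Dom (X \<rightarrow> Y)" and x: "x \<in> Dom X"
  shows "(f \<inter> g) \<bullet> x = f \<bullet> x \<inter> g \<bullet> x"
proof (intro equalityI subsetI)
  fix b assume "b \<in> f \<bullet> x \<inter> g \<bullet> x"
  then obtain U V where U: "Step U b \<in> f" "fset U \<subseteq> x" and V: "Step V b \<in> g" "fset V \<subseteq> x"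
    by (auto simp: app_def)
  have W: "fset (U |\<union>| V) \<subseteq> x" using U V by auto
  note toks = DomD(2)[OF x W] and con = DomD(1)[OF x W finite_fset]
  have "Step (U |\<union>| V) b \<in> f \<inter> g"
    using Step_weaken[OF f U(1) _ toks con] Step_weaken[OF g V(1) _ toks con] by auto
  with W show "b \<in> (f \<inter> g) \<bullet> x" unfolding app_def by blast
qed (auto simp: app_def)

lemma exteq_total: "exteq X x y \<Longrightarrow> is_total X x \<and> is_total X y"
  by (cases X) (auto simp: exteq.simps)

text \<open>
  The intersection serves as a common total approximation. The induction passes function types
  because application commutes with intersections in the function and is monotone in both arguments.
  Reflexivity is then immediate, which says that total functionals respect extensional equality.
\<close>

lemma exteq_iff_total_Int:
  "is_total X x \<Longrightarrow> is_total X y \<Longrightarrow> exteq X x y \<longleftrightarrow> is_total X (x \<inter> y)"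
proof (induction X arbitrary: x y)
  case Boolean
  then obtain a b where "x = truth a" "y = truth b" by (metis total_BooleanE)
  then show ?case by (auto simp: exteq.simps is_total.simps truth_Dom Int_Dom) (auto simp: truth_def)
next
  case Natural
  then obtain a b where "x = num a" "y = num b" by (metis total_NaturalE)
  then show ?case by (auto simp: exteq.simps is_total.simps num_Dom Int_Dom) (auto simp: num_def)
next
  case (Times X Y)
  have "pfst (x \<inter> y) = pfst x \<inter> pfst y" "psnd (x \<inter> y) = psnd x \<inter> psnd y"
    by (auto simp: pfst_def psnd_def)
  then show ?case using Times by (auto simp: is_total.simps exteq.simps intro: Int_Dom)
next
  case (Star X)
  show ?case
  proof
    assume "exteq (Star X) x y"
    then obtain xs ys where xy: "x = seq xs" "y = seq ys" and e: "list_all2 (exteq X) xs ys"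
      by (auto simp: exteq.simps)
    have len: "length ys = length xs" using e by (simp add: list_all2_lengthD)
    let ?zs = "map (\<lambda>i. xs ! i \<inter> ys ! i) [0..<length xs]"
    have "x \<inter> y = seq ?zs" using len unfolding xy seq_def by auto
    moreover have "is_total X (xs ! i \<inter> ys ! i)" if "i < length xs" for i
      using list_all2_nthD[OF e that] Star.IH exteq_total by blast
    ultimately show "is_total (Star X) (x \<inter> y)" by (auto intro!: total_seq)
  next
    assume "is_total (Star X) (x \<inter> y)"
    then obtain zs where zs: "x \<inter> y = seq zs" "\<And>z. z \<in> set zs \<Longrightarrow> is_total X z"
      by (auto simp: is_total.simps)
    obtain xs where xs: "x = seq xs" "\<And>z. z \<in> set xs \<Longrightarrow> is_total X z"
      using Star.prems by (auto simp: is_total.simps)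
    obtain ys where ys: "y = seq ys" "\<And>z. z \<in> set ys \<Longrightarrow> is_total X z"
      using Star.prems by (auto simp: is_total.simps)
    have "Len (length zs) \<in> seq xs \<inter> seq ys" using zs(1) xs(1) ys(1) Len_seq by blast
    then have len: "length xs = length zs" "length ys = length zs" by simp_all
    have "exteq X (xs ! i) (ys ! i)" if i: "i < length zs" for i
    proof -
      have "zs ! i = xs ! i \<inter> ys ! i"
        using i len zs(1) entry_seq[of xs i] entry_seq[of ys i] entry_seq[of zs i]
        unfolding xs(1) ys(1) by auto
      moreover have "is_total X (xs ! i)" "is_total X (ys ! i)" "is_total X (zs ! i)"
        by (rule xs(2) ys(2) zs(2), use i len in simp)+
      ultimately show ?thesis using Star.IH by metis
    qed
    then have "list_all2 (exteq X) xs ys" using len by (simp add: list_all2_conv_all_nth)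
    then show "exteq (Star X) x y" using Star.prems xs(1) ys(1) by (auto simp: exteq.simps)
  qed
next
  case (Arrow X Y)
  note D = Arrow.prems[THEN total_Dom]
  show ?case
  proof
    assume e: "exteq (X \<rightarrow> Y) x y"
    show "is_total (X \<rightarrow> Y) (x \<inter> y)" unfolding is_total.simps
    proof (intro conjI allI impI)
      fix z assume z: "is_total X z"
      then have "exteq X z z" using Arrow.IH(1)[OF z z] by simp
      then have "exteq Y (x \<bullet> z) (y \<bullet> z)" using e by (simp add: exteq.simps)
      then have "is_total Y (x \<bullet> z \<inter> y \<bullet> z)" using Arrow.IH(2) exteq_total by blast
      then show "is_total Y ((x \<inter> y) \<bullet> z)" using app_Int[OF D total_Dom[OF z]] by simp
    qed (rule Int_Dom[OF D])
  next
    assume t: "is_total (X \<rightarrow> Y) (x \<inter> y)"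
    show "exteq (X \<rightarrow> Y) x y" unfolding exteq.simps
    proof (intro conjI allI impI Arrow.prems)
      fix a b assume "exteq X a b"
      then have ab: "is_total X a" "is_total X b" "is_total X (a \<inter> b)"
        using exteq_total Arrow.IH(1) by blast+
      note T = total_app[OF Arrow.prems(1) ab(1)] total_app[OF Arrow.prems(2) ab(2)]
      have "(x \<inter> y) \<bullet> (a \<inter> b) \<subseteq> x \<bullet> a \<inter> y \<bullet> b" by (auto simp: app_def)
      then have "is_total Y (x \<bullet> a \<inter> y \<bullet> b)"
        using total_upward[OF total_app[OF t ab(3)]] Int_Dom[OF T[THEN total_Dom]] by blast
      then show "exteq Y (x \<bullet> a) (y \<bullet> b)" using Arrow.IH(2)[OF T] by blast
    qed
  qed
qed

lemma exteq_refl: "is_total X x \<Longrightarrow> exteq X x x"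
  by (simp add: exteq_iff_total_Int)

lemma exteq_sym: "exteq X x y \<Longrightarrow> exteq X y x"
  using exteq_total exteq_iff_total_Int by (metis Int_commute)

text \<open>
  Totality of \<open>x \<inter> y\<close> and \<open>y \<inter> z\<close> does not directly give that of \<open>x \<inter> z\<close>, so this goes by induction
  on the type. At function types the hypotheses are used at the pairs \<open>a, a\<close> and \<open>a, b\<close>.
\<close>

lemma exteq_trans: "exteq X x y \<Longrightarrow> exteq X y z \<Longrightarrow> exteq X x z"
proof (induction X arbitrary: x y z)
  case (Times X Y)
  then show ?case unfolding exteq.simps by blast
next
  case (Star X)
  then obtain xs ys ys' zs where
    "x = seq xs" "y = seq ys" "y = seq ys'" "z = seq zs"
    and e: "list_all2 (exteq X) xs ys" "list_all2 (exteq X) ys' zs"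
    by (auto simp: exteq.simps)
  moreover from this have "ys = ys'" using seq_inject by blast
  moreover from this have "list_all2 (exteq X) xs zs"
    using list_all2_trans[of "exteq X" "exteq X" "exteq X"] e Star.IH by blast
  ultimately show ?case using Star.prems unfolding exteq.simps by blast
next
  case (Arrow X Y)
  show ?case unfolding exteq.simps
  proof (intro conjI allI impI)
    fix a b assume ab: "exteq X a b"
    then have "exteq X a a" using exteq_total exteq_refl by blast
    then show "exteq Y (x \<bullet> a) (z \<bullet> b)"
      using Arrow ab unfolding exteq.simps by blast
  qed (use Arrow.prems exteq_total in blast)+
qed (simp_all add: exteq.simps)


section \<open>Classes of total elements\<close>

lemma cls_eq_iff: "is_total X x \<Longrightarrow> is_total X y \<Longrightarrow> cls X x = cls X y \<longleftrightarrow> exteq X x y"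
  unfolding cls_def set_eq_iff mem_Collect_eq using exteq_refl exteq_sym exteq_trans by metis

lemma KK_cls: "is_total X x \<Longrightarrow> cls X x \<in> KK X"
  unfolding KK_def cls_def quotient_def by auto

lemma KK_E:
  assumes "A \<in> KK X" obtains x where "is_total X x" "A = cls X x"
  using assms unfolding KK_def cls_def quotient_def by auto

text \<open>This is how operations on classes are reduced to operations on representatives.\<close>

lemma UN_cls_eq:
  assumes "is_total X x" "\<And>y. exteq X x y \<Longrightarrow> f y = C"
  shows "(\<Union>y\<in>cls X x. f y) = C"
proof -
  have "x \<in> cls X x" using exteq_refl[OF assms(1)] by (simp add: cls_def)
  moreover have "f y = C" if "y \<in> cls X x" for y using that assms(2) by (simp add: cls_def)
  ultimately show ?thesis by blast
qed

lemma cls_eqI: "exteq X x y \<Longrightarrow> cls X y = cls X x"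
  using cls_eq_iff exteq_total by metis

lemma kapp_cls:
  assumes f: "is_total (X \<rightarrow> Y) f" and x: "is_total X x"
  shows "kapp Y (cls (X \<rightarrow> Y) f) (cls X x) = cls Y (f \<bullet> x)"
  unfolding kapp_def
  by (intro UN_cls_eq[OF f] UN_cls_eq[OF x] cls_eqI) (simp add: exteq.simps)

lemma kfst_cls: "is_total (X \<otimes> Y) p \<Longrightarrow> kfst X (cls (X \<otimes> Y) p) = cls X (pfst p)"
  unfolding kfst_def by (rule UN_cls_eq) (simp_all add: cls_eqI exteq.simps(3))

lemma ksnd_cls: "is_total (X \<otimes> Y) p \<Longrightarrow> ksnd Y (cls (X \<otimes> Y) p) = cls Y (psnd p)"
  unfolding ksnd_def by (rule UN_cls_eq) (simp_all add: cls_eqI exteq.simps(3))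

lemma cls_num_eq_iff: "cls Natural (num m) = cls Natural (num n) \<longleftrightarrow> m = n"
  by (simp add: cls_eq_iff exteq.simps)

lemma cls_truth_eq_iff: "cls Boolean (truth a) = cls Boolean (truth b) \<longleftrightarrow> a = b"
  by (simp add: cls_eq_iff exteq.simps)


section \<open>Streams\<close>

text \<open>
  The strict functional with prescribed values at the numerals. \<^const>\<open>ext\<close>, \<^const>\<open>spec\<close> and
  \<^const>\<open>append_seq\<close> all have this form, so what they do is determined by a sequence of ideals.
\<close>

definition stream_of :: "(nat \<Rightarrow> tok set) \<Rightarrow> tok set" where
  "stream_of s = lam Natural (\<lambda>k. nat_case k s)"

lemma Step_stream_of_iff:
  "Step U b \<in> stream_of s \<longleftrightarrow> (\<exists>n. fset U = {NatTok n} \<and> b \<in> s n)"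
proof
  assume "Step U b \<in> stream_of s"
  then obtain n where n: "con Natural (fset U)" "NatTok n \<in> fset U" "b \<in> s n"
    by (simp add: stream_of_def lam_def nat_case_def ded_closure_def) blast
  have "t = NatTok n" if "t \<in> fset U" for t
    by (rule n(1)[unfolded con.simps, THEN bspec, THEN bspec, OF that n(2)])
  with n(2,3) show "\<exists>n. fset U = {NatTok n} \<and> b \<in> s n" by blast
next
  assume "\<exists>n. fset U = {NatTok n} \<and> b \<in> s n"
  then show "Step U b \<in> stream_of s"
    by (elim exE conjE) (simp add: stream_of_def lam_def nat_case_def ded_closure_def)
qed

lemma stream_of_num [simp]: "stream_of s \<bullet> num n = s n"
proof (intro equalityI subsetI)
  fix b assume "b \<in> stream_of s \<bullet> num n"
  then show "b \<in> s n" unfolding app_def by (auto simp: Step_stream_of_iff num_def)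
next
  fix b assume "b \<in> s n"
  then have "Step {|NatTok n|} b \<in> stream_of s" by (simp add: Step_stream_of_iff)
  moreover have "fset {|NatTok n|} \<subseteq> num n" by (simp add: num_def)
  ultimately show "b \<in> stream_of s \<bullet> num n" unfolding app_def by blast
qed

lemma stream_of_cont:
  assumes "\<And>n. s n \<in> Dom X" shows "scott_cont Natural X (\<lambda>k. nat_case k s)"
  by (intro scott_cont_nat_case scott_cont_id scott_cont_const assms)

lemma stream_of_total: "(\<And>n. is_total X (s n)) \<Longrightarrow> is_total (Stream X) (stream_of s)"
  unfolding stream_of_def
  by (auto intro!: total_lam stream_of_cont total_Dom elim!: total_NaturalE)

lemma exteq_stream_of:
  assumes w: "is_total (Stream X) w" and e: "\<And>n. exteq X (w \<bullet> num n) (s n)"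
  shows "exteq (Stream X) w (stream_of s)"
  unfolding exteq.simps(5)
proof (intro conjI allI impI w stream_of_total)
  show "is_total X (s n)" for n using exteq_total[OF e] by blast
  fix x y assume "exteq Natural x y"
  then have "is_total Natural x" "y = x" unfolding exteq.simps by auto
  then show "exteq X (w \<bullet> x) (stream_of s \<bullet> y)" using e by (auto elim!: total_NaturalE)
qed

text \<open>
  Uniqueness holds because a total stream is determined, up to extensional equality, by its values
  at the numerals: these are the only total arguments.
\<close>

lemma kstream_cls:
  assumes s: "\<And>n. is_total X (s n)"
  shows "kstream X (\<lambda>n. cls X (s n)) = cls (Stream X) (stream_of s)"
  unfolding kstream_def
proof (rule the_equality)
  note S = stream_of_total[of X s, OF s]
  show "cls (Stream X) (stream_of s) \<in> KK (Stream X) \<and>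
      (\<forall>n. knth X (cls (Stream X) (stream_of s)) n = cls X (s n))"
    using S by (simp add: KK_cls kapp_cls)
  fix w assume w: "w \<in> KK (Stream X) \<and> (\<forall>n. knth X w n = cls X (s n))"
  then obtain v where v: "is_total (Stream X) v" "w = cls (Stream X) v" by (auto elim: KK_E)
  have "exteq X (v \<bullet> num n) (s n)" for n
    using w v s by (simp add: kapp_cls cls_eq_iff[OF total_app[OF v(1)]])
  then have "exteq (Stream X) v (stream_of s)" by (rule exteq_stream_of[OF v(1)])
  then show "w = cls (Stream X) (stream_of s)" using v S cls_eq_iff by blast
qed

text \<open>
  The tokens of \<^term>\<open>stream_of s\<close> mention single arguments, so that finitely many of them see only
  an initial segment of \<open>s\<close>.
\<close>

lemma finite_subset_stream_of:
  assumes "finite W" "W \<subseteq> stream_of s"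
  shows "\<exists>N. \<forall>s'. (\<forall>n<N. s' n = s n) \<longrightarrow> W \<subseteq> stream_of s'"
  using assms
proof (induction W rule: finite_induct)
  case (insert t W)
  then obtain N where N: "\<And>s'. (\<forall>n<N. s' n = s n) \<Longrightarrow> W \<subseteq> stream_of s'" by blast
  have "t \<in> stream_of s" using insert.prems by simp
  moreover from this obtain U b where t: "t = Step U b" by (auto simp: stream_of_def lam_def)
  ultimately obtain n where n: "fset U = {NatTok n}" "b \<in> s n" by (auto simp: Step_stream_of_iff)
  have "insert t W \<subseteq> stream_of s'" if "\<forall>i<max N (Suc n). s' i = s i" for s'
    using that N[of s'] n t by (auto simp: Step_stream_of_iff)
  then show ?case by blast
qed simp


section \<open>Terms of system T denote total elements\<close>

text \<open>
  A term is evaluated in an environment that varies continuously with a parameter of arbitrary type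
  \<open>A\<close>. This generality lets the induction pass an abstraction: its body is used once with the bound
  variable fixed and once with the bound variable as the parameter.
\<close>

lemma typed_scott_cont:
  "\<Gamma> \<turnstile> t : Y \<Longrightarrow> list_all2 (scott_cont A) \<Gamma> hs \<Longrightarrow> scott_cont A Y (\<lambda>a. den t (map (\<lambda>h. h a) hs))"
proof (induction arbitrary: A hs rule: typed.induct)
  case (1 i \<Gamma>)
  then have "i < length hs" by (simp add: list_all2_lengthD)
  then show ?case using list_all2_nthD[OF 1(2,1)] by simp
next
  case (2 X \<Gamma> t Y)
  have "scott_cont A Y (\<lambda>a. den t (b # map (\<lambda>h. h a) hs))" if b: "b \<in> Dom X" for b
    using 2(2)[of A "(\<lambda>_. b) # hs"] 2(3) scott_cont_const[OF b] by simp
  moreover have "scott_cont X Y (\<lambda>b. den t (b # map (\<lambda>h. h a) hs))" if a: "a \<in> Dom A" for a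
  proof -
    have "list_all2 (scott_cont X) \<Gamma> (map (\<lambda>h _. h a) hs)"
      using 2(3) by (auto simp: list_all2_conv_all_nth intro!: scott_cont_const scott_cont_Dom[OF _ a])
    then show ?thesis
      using 2(2)[of X "(\<lambda>b. b) # map (\<lambda>h _. h a) hs"] scott_cont_id by (simp add: comp_def)
  qed
  ultimately show ?case by (auto intro: scott_cont_lam)
next
  case (3 \<Gamma> s X Y t)
  show ?case unfolding den.simps by (rule scott_cont_app_app[OF "3.IH"(1)[OF "3.prems"] "3.IH"(2)[OF "3.prems"]])
next
  case (4 \<Gamma> b)
  then show ?case by (simp add: scott_cont_const truth_Dom)
next
  case (5 \<Gamma> r s X t)
  then show ?case by (auto intro!: scott_cont_bool_case scott_cont_if)
next
  case (6 \<Gamma>)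
  then show ?case by (simp add: scott_cont_const num_Dom)
next
  case (7 \<Gamma> t)
  then show ?case by (auto intro!: scott_cont_nat_case scott_cont_const num_Dom)
next
  case (8 \<Gamma> r X s t)
  let ?\<rho> = "\<lambda>a. map (\<lambda>h. h a) hs"
  have "scott_cont A X (\<lambda>a. rec_nat (den r (?\<rho> a)) (\<lambda>n y. den s (?\<rho> a) \<bullet> num n \<bullet> y) n)" for n
  proof (induction n)
    case 0
    then show ?case using 8 by simp
  next
    case (Suc n)
    show ?case unfolding nat.rec
      by (rule scott_cont_app_app[OF scott_cont_app_app[OF _ scott_cont_const[OF num_Dom]] Suc])
        (use 8 in blast)
  qed
  then show ?case using 8 by (auto intro!: scott_cont_nat_case)
next
  case (9 \<Gamma> s X t Y)
  show ?case unfolding den.simps by (rule scott_cont_pair[OF "9.IH"(1)[OF "9.prems"] "9.IH"(2)[OF "9.prems"]])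
next
  case (10 \<Gamma> t X Y)
  show ?case unfolding den.simps by (rule scott_cont_pfst[OF "10.IH"[OF "10.prems"]])
next
  case (11 \<Gamma> t X Y)
  show ?case unfolding den.simps by (rule scott_cont_psnd[OF "11.IH"[OF "11.prems"]])
next
  case (12 \<Gamma> X)
  then show ?case by (auto intro!: scott_cont_const seq_Dom)
next
  case (13 \<Gamma> s X t)
  have "scott_cont A (Star X) (\<lambda>a. seq (den s (map (\<lambda>h. h a) hs) # map (\<lambda>h. h a) gs))"
    if "\<And>h. h \<in> set gs \<Longrightarrow> scott_cont A X h" for gs
    using scott_cont_seq[of "(\<lambda>a. den s (map (\<lambda>h. h a) hs)) # gs" A X] that 13 by auto
  then show ?case using 13 by (auto intro!: scott_cont_seq_case)
next
  case (14 \<Gamma> r Y s X t)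
  let ?\<rho> = "\<lambda>a. map (\<lambda>h. h a) hs"
  have "scott_cont A Y (\<lambda>a. rec_list (den r (?\<rho> a)) (\<lambda>x xs y. den s (?\<rho> a) \<bullet> x \<bullet> seq xs \<bullet> y)
      (map (\<lambda>h. h a) gs))"
    if "\<And>h. h \<in> set gs \<Longrightarrow> scott_cont A X h" for gs
    using that
  proof (induction gs)
    case Nil
    then show ?case using 14 by simp
  next
    case (Cons g gs)
    have s: "scott_cont A (X \<rightarrow> Star X \<rightarrow> Y \<rightarrow> Y) (\<lambda>a. den s (?\<rho> a))" using 14 by blast
    have "scott_cont A X g" "scott_cont A (Star X) (\<lambda>a. seq (map (\<lambda>h. h a) gs))"
      using Cons.prems by (auto intro: scott_cont_seq)
    note 1 = scott_cont_app_app[OF scott_cont_app_app[OF s this(1)] this(2)]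
    show ?case unfolding list.map list.rec
      by (rule scott_cont_app_app[OF 1 Cons.IH]) (use Cons.prems in simp)
  qed
  then show ?case using 14 by (auto intro!: scott_cont_seq_case)
qed

text \<open>
  Totality is the logical relation for system T: the recursors only iterate total functions along a
  number or a list.
\<close>

lemma typed_total: "\<Gamma> \<turnstile> t : Y \<Longrightarrow> list_all2 is_total \<Gamma> \<rho> \<Longrightarrow> is_total Y (den t \<rho>)"
proof (induction arbitrary: \<rho> rule: typed.induct)
  case (1 i \<Gamma>)
  then show ?case using list_all2_nthD by fastforce
next
  case (2 X \<Gamma> t Y)
  have "list_all2 (scott_cont X) \<Gamma> (map (\<lambda>x _. x) \<rho>)"
    using 2(3) by (auto simp: list_all2_conv_all_nth intro!: scott_cont_const total_Dom)
  then have "scott_cont X Y (\<lambda>x. den t (x # \<rho>))"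
    using typed_scott_cont[OF 2(1), of X "(\<lambda>x. x) # map (\<lambda>x _. x) \<rho>"] scott_cont_id
    by (simp add: comp_def)
  then show ?case using 2 by (auto intro!: total_lam)
next
  case (5 \<Gamma> r s X t)
  have "is_total Boolean (den r \<rho>)" using 5 by blast
  then obtain b where "den r \<rho> = truth b" by (rule total_BooleanE)
  then show ?case using 5 by simp
next
  case (7 \<Gamma> t)
  then have "is_total Natural (den t \<rho>)" by blast
  then obtain n where "den t \<rho> = num n" by (rule total_NaturalE)
  then show ?case by simp
next
  case (8 \<Gamma> r X s t)
  have "is_total Natural (den t \<rho>)" using 8 by blast
  then obtain n where n: "den t \<rho> = num n" by (rule total_NaturalE)
  have s: "is_total (Natural \<rightarrow> X \<rightarrow> X) (den s \<rho>)" using 8 by blast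
  have "is_total X (rec_nat (den r \<rho>) (\<lambda>n y. den s \<rho> \<bullet> num n \<bullet> y) n)"
    by (induction n) (use 8 in \<open>auto intro!: total_app[OF total_app[OF s]]\<close>)
  then show ?case by (simp add: n)
next
  case (13 \<Gamma> s X t)
  then have "is_total (Star X) (den t \<rho>)" by blast
  then obtain xs where "den t \<rho> = seq xs" "\<And>x. x \<in> set xs \<Longrightarrow> is_total X x"
    by (auto simp: is_total.simps)
  then show ?case using 13 by (auto intro!: total_seq)
next
  case (14 \<Gamma> r Y s X t)
  then have "is_total (Star X) (den t \<rho>)" by blast
  then obtain xs where xs: "den t \<rho> = seq xs" "\<And>x. x \<in> set xs \<Longrightarrow> is_total X x"
    by (auto simp: is_total.simps)
  have s: "is_total (X \<rightarrow> Star X \<rightarrow> Y \<rightarrow> Y) (den s \<rho>)" using 14 by blast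
  have "is_total Y (rec_list (den r \<rho>) (\<lambda>x xs y. den s \<rho> \<bullet> x \<bullet> seq xs \<bullet> y) xs)"
    using xs(2) by (induction xs)
      (use 14 in \<open>auto intro!: total_app[OF total_app[OF total_app[OF s]]] total_seq\<close>)
  then show ?case by (simp add: xs(1))
qed (auto intro: total_app total_pair total_seq total_pfst total_psnd)

lemma primrec_relation_total: "primrec_relation X R \<Longrightarrow> is_total (X \<rightarrow> X \<rightarrow> Boolean) R"
  unfolding primrec_relation_def using typed_total by fastforce


section \<open>Continuity of the defining equation\<close>

lemma Dom_function_eqI:
  assumes "f \<in> Dom (X \<rightarrow> Y)" "g \<in> Dom (X \<rightarrow> Y)" "\<And>x. x \<in> Dom X \<Longrightarrow> f \<bullet> x = g \<bullet> x"
  shows "f = g"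
  using assms by (intro equalityI) (simp_all add: app_le_iff)

lemma scott_cont_stream_of:
  assumes s: "\<And>n. scott_cont A X (\<lambda>a. s a n)"
  shows "scott_cont A (Stream X) (\<lambda>a. stream_of (s a))"
  unfolding stream_of_def
proof (rule scott_cont_lam)
  show "scott_cont A X (\<lambda>a. nat_case k (s a))" if "k \<in> Dom Natural" for k
    by (rule scott_cont_nat_case[OF scott_cont_const[OF that] s])
  show "scott_cont Natural X (\<lambda>k. nat_case k (s a))" if "a \<in> Dom A" for a
    by (rule stream_of_cont) (rule scott_cont_Dom[OF s that])
qed

lemma ext_eq_stream_of: "ext Z \<alpha> m = stream_of (\<lambda>n. if n < m then \<alpha> \<bullet> num n else zero Z)"
  by (simp add: ext_def stream_of_def)

lemma spec_eq_stream_of: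
  "spec Z \<alpha> F = stream_of (\<lambda>n.
     foldr (\<lambda>m E. nat_case (F \<bullet> ext Z \<alpha> m) (\<lambda>k. if k < m then zero Z else E))
       [0..<Suc n] (\<alpha> \<bullet> num n))"
  unfolding spec_def stream_of_def ..

lemma append_seq_eq_stream_of:
  "append_seq s v = stream_of (\<lambda>k. seq_case s (\<lambda>xs.
     if k < length xs then xs ! k else v \<bullet> num (k - length xs)))"
  unfolding append_seq_def stream_of_def ..

lemma append_initial_seg:
  "append_seq (initial_seg u (num n)) v = stream_of (\<lambda>k. if k < n then u \<bullet> num k else v \<bullet> num (k - n))"
  unfolding append_seq_eq_stream_of initial_seg_def
  by (rule arg_cong[where f = stream_of]) (auto simp: fun_eq_iff)

lemma scott_cont_nth:
  assumes "scott_cont A (Stream X) u" shows "scott_cont A X (\<lambda>a. u a \<bullet> num n)"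
  by (rule scott_cont_app_app[OF assms scott_cont_const[OF num_Dom]])

lemma scott_cont_ext:
  assumes "scott_cont A (Stream Z) \<alpha>" shows "scott_cont A (Stream Z) (\<lambda>a. ext Z (\<alpha> a) m)"
  unfolding ext_eq_stream_of
  by (intro scott_cont_stream_of scott_cont_if scott_cont_nth assms scott_cont_const zero_Dom)

lemma scott_cont_spec:
  assumes \<alpha>: "scott_cont A (Stream Z) \<alpha>" and F: "scott_cont A (Stream Z \<rightarrow> Natural) F"
  shows "scott_cont A (Stream Z) (\<lambda>a. spec Z (\<alpha> a) (F a))"
proof -
  have "scott_cont A Z (\<lambda>a. foldr (\<lambda>m E. nat_case (F a \<bullet> ext Z (\<alpha> a) m) (\<lambda>k. if k < m then zero Z else E))
      ms (\<alpha> a \<bullet> num n))" for ms n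
  proof (induction ms)
    case Nil
    then show ?case by (simp add: scott_cont_nth[OF \<alpha>])
  next
    case (Cons m ms)
    show ?case unfolding foldr.simps comp_def
      by (intro scott_cont_nat_case scott_cont_app_app[OF F] scott_cont_ext \<alpha> scott_cont_if
          scott_cont_const zero_Dom Cons.IH)
  qed
  then show ?thesis unfolding spec_eq_stream_of by (rule scott_cont_stream_of)
qed

lemma scott_cont_initial_seg:
  assumes u: "scott_cont A (Stream X) u" and n: "scott_cont A Natural n"
  shows "scott_cont A (Star X) (\<lambda>a. initial_seg (u a) (n a))"
  unfolding initial_seg_def
proof (rule scott_cont_nat_case[OF n])
  fix n
  have "scott_cont A (Star X) (\<lambda>a. seq (map (\<lambda>h. h a) (map (\<lambda>i a. u a \<bullet> num i) [0..<n])))"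
    by (rule scott_cont_seq) (auto intro: scott_cont_nth[OF u])
  then show "scott_cont A (Star X) (\<lambda>a. seq (map (\<lambda>i. u a \<bullet> num i) [0..<n]))"
    by (simp add: comp_def)
qed

lemma scott_cont_append_seq:
  assumes s: "scott_cont A (Star X) s" and v: "scott_cont A (Stream X) v"
  shows "scott_cont A (Stream X) (\<lambda>a. append_seq (s a) (v a))"
  unfolding append_seq_eq_stream_of
proof (intro scott_cont_stream_of scott_cont_seq_case[OF s])
  fix k hs assume hs: "\<And>h. h \<in> set hs \<Longrightarrow> scott_cont A X h"
  show "scott_cont A X (\<lambda>a. if k < length (map (\<lambda>h. h a) hs) then map (\<lambda>h. h a) hs ! k
      else v a \<bullet> num (k - length (map (\<lambda>h. h a) hs)))"
    using hs[OF nth_mem] by (cases "k < length hs") (simp_all add: scott_cont_nth[OF v])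
qed

lemma scott_cont_if_else_zero:
  assumes "scott_cont A Y E" "scott_cont A Boolean b"
  shows "scott_cont A Y (\<lambda>a. if_else_zero Y (E a) (b a))"
  unfolding if_else_zero_def
  by (intro scott_cont_bool_case scott_cont_if assms scott_cont_const zero_Dom)

text \<open>
  The second component of the \<open>n\<close>-th entry of \<^const>\<open>EOR_seq\<close>.
\<close>

abbreviation EOR_branch ::
    "ty \<Rightarrow> ty \<Rightarrow> tok set \<Rightarrow> tok set \<Rightarrow> tok set \<Rightarrow> tok set \<Rightarrow> tok set \<Rightarrow> tok set \<Rightarrow> tok set" where
  "EOR_branch X Y R \<Phi> H F u n \<equiv> lam (Stream X) (\<lambda>v.
     if_else_zero Y (\<Phi> \<bullet> H \<bullet> F \<bullet> append_seq (initial_seg u n) v) (below R (v \<bullet> num 0) (u \<bullet> n)))"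

context
  fixes X Y :: ty and R :: "tok set"
  assumes R: "R \<in> Dom (X \<rightarrow> X \<rightarrow> Boolean)"
begin

text \<open>
  All arguments vary with one common parameter, since \<open>scott_cont_lam\<close> asks for continuity in the
  bound variable and, separately, in the parameter; one statement then serves both premises of each
  enclosing abstraction.
\<close>

lemma scott_cont_EOR_branch_body:
  assumes "scott_cont A (EOR_ty X Y) \<Phi>" "scott_cont A (Stream (EOR_arg X Y) \<rightarrow> Y) H"
    "scott_cont A (Stream (EOR_arg X Y) \<rightarrow> Natural) F" "scott_cont A (Stream X) u"
    "scott_cont A Natural n" "scott_cont A (Stream X) v"
  shows "scott_cont A Y (\<lambda>a. if_else_zero Y
      (\<Phi> a \<bullet> H a \<bullet> F a \<bullet> append_seq (initial_seg (u a) (n a)) (v a)) (below R (v a \<bullet> num 0) (u a \<bullet> n a)))"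
  unfolding below_def
  by (rule scott_cont_if_else_zero scott_cont_append_seq scott_cont_initial_seg scott_cont_nth
      scott_cont_const[OF R] assms | rule scott_cont_app_app)+

lemma scott_cont_EOR_branch:
  assumes "scott_cont A (EOR_ty X Y) \<Phi>" "scott_cont A (Stream (EOR_arg X Y) \<rightarrow> Y) H"
    "scott_cont A (Stream (EOR_arg X Y) \<rightarrow> Natural) F" "scott_cont A (Stream X) u"
    "scott_cont A Natural n"
  shows "scott_cont A (Stream X \<rightarrow> Y) (\<lambda>a. EOR_branch X Y R (\<Phi> a) (H a) (F a) (u a) (n a))"
  by (rule scott_cont_lam; rule scott_cont_EOR_branch_body)
    (blast intro: assms scott_cont_const scott_cont_id assms[THEN scott_cont_Dom])+

lemma scott_cont_EOR_seq:
  assumes "scott_cont A (EOR_ty X Y) \<Phi>" "scott_cont A (Stream (EOR_arg X Y) \<rightarrow> Y) H"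
    "scott_cont A (Stream (EOR_arg X Y) \<rightarrow> Natural) F" "scott_cont A (Stream X) u"
  shows "scott_cont A (Stream (EOR_arg X Y)) (\<lambda>a. EOR_seq X Y R (\<Phi> a) (H a) (F a) (u a))"
  unfolding EOR_seq_def
  by (rule scott_cont_lam; rule scott_cont_pair, rule scott_cont_app_app, rule_tac [3] scott_cont_EOR_branch)
    (blast intro: assms scott_cont_const scott_cont_id assms[THEN scott_cont_Dom])+

text \<open>
  The operator whose fixpoints in \<^term>\<open>Dom (EOR_ty X Y)\<close> are the solutions of the defining equation.
\<close>

definition EOR_op :: "tok set \<Rightarrow> tok set" where
  "EOR_op \<Phi> =
     lam (Stream (EOR_arg X Y) \<rightarrow> Y) (\<lambda>H. lam (Stream (EOR_arg X Y) \<rightarrow> Natural) (\<lambda>F.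
       lam (Stream X) (\<lambda>u. H \<bullet> spec (EOR_arg X Y) (EOR_seq X Y R \<Phi> H F u) F)))"

lemma scott_cont_EOR_body:
  assumes "scott_cont A (EOR_ty X Y) \<Phi>" "scott_cont A (Stream (EOR_arg X Y) \<rightarrow> Y) H"
    "scott_cont A (Stream (EOR_arg X Y) \<rightarrow> Natural) F" "scott_cont A (Stream X) u"
  shows "scott_cont A Y (\<lambda>a. H a \<bullet> spec (EOR_arg X Y) (EOR_seq X Y R (\<Phi> a) (H a) (F a) (u a)) (F a))"
  by (intro scott_cont_app_app[OF assms(2)] scott_cont_spec scott_cont_EOR_seq assms)

lemma scott_cont_EOR_lam_u:
  assumes "scott_cont A (EOR_ty X Y) \<Phi>" "scott_cont A (Stream (EOR_arg X Y) \<rightarrow> Y) H"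
    "scott_cont A (Stream (EOR_arg X Y) \<rightarrow> Natural) F"
  shows "scott_cont A (Stream X \<rightarrow> Y) (\<lambda>a. lam (Stream X) (\<lambda>u.
    H a \<bullet> spec (EOR_arg X Y) (EOR_seq X Y R (\<Phi> a) (H a) (F a) u) (F a)))"
  by (rule scott_cont_lam; rule scott_cont_EOR_body)
    (blast intro: assms scott_cont_const scott_cont_id assms[THEN scott_cont_Dom])+

lemma scott_cont_EOR_lam_F:
  assumes "scott_cont A (EOR_ty X Y) \<Phi>" "scott_cont A (Stream (EOR_arg X Y) \<rightarrow> Y) H"
  shows "scott_cont A ((Stream (EOR_arg X Y) \<rightarrow> Natural) \<rightarrow> Stream X \<rightarrow> Y)
    (\<lambda>a. lam (Stream (EOR_arg X Y) \<rightarrow> Natural) (\<lambda>F. lam (Stream X) (\<lambda>u.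
      H a \<bullet> spec (EOR_arg X Y) (EOR_seq X Y R (\<Phi> a) (H a) F u) F)))"
  by (rule scott_cont_lam; rule scott_cont_EOR_lam_u)
    (blast intro: assms scott_cont_const scott_cont_id assms[THEN scott_cont_Dom])+

lemma scott_cont_EOR_op: "scott_cont (EOR_ty X Y) (EOR_ty X Y) EOR_op"
  unfolding EOR_op_def
  by (rule scott_cont_lam; rule scott_cont_EOR_lam_F)
    (blast intro: scott_cont_const scott_cont_id)+

lemma EOR_op_app:
  assumes "\<Phi> \<in> Dom (EOR_ty X Y)" "H \<in> Dom (Stream (EOR_arg X Y) \<rightarrow> Y)"
    "F \<in> Dom (Stream (EOR_arg X Y) \<rightarrow> Natural)" "u \<in> Dom (Stream X)"
  shows "EOR_op \<Phi> \<bullet> H \<bullet> F \<bullet> u = H \<bullet> spec (EOR_arg X Y) (EOR_seq X Y R \<Phi> H F u) F"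
proof -
  note c = scott_cont_const[OF assms(1)] scott_cont_const[OF assms(2)] scott_cont_const[OF assms(3)]
  show ?thesis
    unfolding EOR_op_def
      app_lam[OF scott_cont_EOR_lam_F[OF c(1) scott_cont_id] assms(2)]
      app_lam[OF scott_cont_EOR_lam_u[OF c(1,2) scott_cont_id] assms(3)]
      app_lam[OF scott_cont_EOR_body[OF c scott_cont_id] assms(4)] ..
qed

lemma EOR_equation_iff_fixpoint:
  assumes \<Phi>: "\<Phi> \<in> Dom (EOR_ty X Y)"
  shows "EOR_equation X Y R \<Phi> \<longleftrightarrow> EOR_op \<Phi> = \<Phi>"
proof
  show "EOR_equation X Y R \<Phi>" if "EOR_op \<Phi> = \<Phi>"
    unfolding EOR_equation_def using EOR_op_app[OF \<Phi>] that by metis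
next
  assume e: "EOR_equation X Y R \<Phi>"
  note op = scott_cont_Dom[OF scott_cont_EOR_op \<Phi>]
  show "EOR_op \<Phi> = \<Phi>"
  proof (rule Dom_function_eqI[OF op \<Phi>])
    fix H assume H: "H \<in> Dom (Stream (EOR_arg X Y) \<rightarrow> Y)"
    note opH = app_Dom[OF op H] and \<Phi>H = app_Dom[OF \<Phi> H]
    show "EOR_op \<Phi> \<bullet> H = \<Phi> \<bullet> H"
    proof (rule Dom_function_eqI[OF opH \<Phi>H])
      fix F assume F: "F \<in> Dom (Stream (EOR_arg X Y) \<rightarrow> Natural)"
      show "EOR_op \<Phi> \<bullet> H \<bullet> F = \<Phi> \<bullet> H \<bullet> F"
      proof (rule Dom_function_eqI[OF app_Dom[OF opH F] app_Dom[OF \<Phi>H F]])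
        fix u assume "u \<in> Dom (Stream X)"
        then show "EOR_op \<Phi> \<bullet> H \<bullet> F \<bullet> u = \<Phi> \<bullet> H \<bullet> F \<bullet> u"
          using EOR_op_app[OF \<Phi> H F] e H F unfolding EOR_equation_def by simp
      qed
    qed
  qed
qed

end


section \<open>The least fixpoint\<close>

text \<open>
  Kleene's iteration: the union of the chain \<open>T\<^sup>n {}\<close> is an ideal because each finite part of it
  already lies in one member of the chain, and for the same reason it is a fixpoint.
\<close>

lemma kleene_fixpoint:
  assumes T: "scott_cont D D T"
  shows "\<exists>x\<in>Dom D. T x = x \<and> (\<forall>y\<in>Dom D. T y = y \<longrightarrow> x \<subseteq> y)"
proof -
  define c where "c n = (T ^^ n) {}" for n
  have c_Dom: "c n \<in> Dom D" for n
    by (induction n) (simp_all add: c_def empty_Dom scott_cont_Dom[OF T])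
  have c_Suc: "c (Suc n) = T (c n)" for n by (simp add: c_def)
  have "c n \<subseteq> c (Suc n)" for n
  proof (induction n)
    case (Suc n)
    show ?case using scott_cont_mono[OF T c_Dom c_Dom Suc.IH] by (simp only: c_Suc)
  qed (simp add: c_def)
  then have c_mono: "c m \<subseteq> c n" if "m \<le> n" for m n using lift_Suc_mono_le that by metis
  define x where "x = (\<Union>n. c n)"
  have fin: "\<exists>n. W \<subseteq> c n" if "finite W" "W \<subseteq> x" for W
    using that
  proof (induction W rule: finite_induct)
    case (insert t W)
    then obtain m n where "W \<subseteq> c m" "t \<in> c n" by (auto simp: x_def)
    then have "insert t W \<subseteq> c (max m n)" using c_mono[of m "max m n"] c_mono[of n "max m n"] by auto
    then show ?case ..
  qed simp
  have x: "x \<in> Dom D"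
  proof (rule DomI)
    show "x \<subseteq> toks D" using Dom_toks[OF c_Dom] by (auto simp: x_def)
    fix W assume W: "finite W" "W \<subseteq> x"
    then obtain n where n: "W \<subseteq> c n" using fin by blast
    show "con D W" by (rule DomD(1)[OF c_Dom n W(1)])
    show "a \<in> x" if "a \<in> toks D" "entails D W a" for a
      using DomD(3)[OF c_Dom n W(1) that(2,1)] by (auto simp: x_def)
  qed
  moreover have "T x = x"
  proof (intro equalityI subsetI)
    fix b assume "b \<in> T x"
    then obtain W where W: "finite W" "W \<subseteq> x" "{b} \<subseteq> T (ded_closure D W)"
      using scott_cont_finite_support[OF T x, of "{b}"] by blast
    then obtain n where n: "W \<subseteq> c n" using fin by blast
    have "T (ded_closure D W) \<subseteq> T (c n)"
      by (rule scott_cont_mono[OF T ded_closure_Dom_le[OF x W(1,2)] c_Dom ded_closure_le[OF c_Dom W(1) n]])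
    then have "b \<in> c (Suc n)" using W(3) c_Suc by blast
    then show "b \<in> x" by (auto simp: x_def)
  next
    fix b assume "b \<in> x"
    then obtain n where "b \<in> c n" by (auto simp: x_def)
    then have b: "b \<in> c (Suc n)" using c_mono[of n "Suc n"] by auto
    have "T (c n) \<subseteq> T x" by (rule scott_cont_mono[OF T c_Dom x]) (auto simp: x_def)
    then show "b \<in> T x" using b c_Suc by blast
  qed
  moreover have "x \<subseteq> y" if y: "y \<in> Dom D" "T y = y" for y
  proof -
    have "c n \<subseteq> y" for n
    proof (induction n)
      case (Suc n)
      show ?case using scott_cont_mono[OF T c_Dom y(1) Suc.IH] y(2) by (simp only: c_Suc)
    qed (simp add: c_def)
    then show ?thesis by (auto simp: x_def)
  qed
  ultimately show ?thesis by blast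
qed

lemma EOR_least_fixpoint_exists:
  assumes R: "R \<in> Dom (X \<rightarrow> X \<rightarrow> Boolean)"
  obtains \<Phi> where "EOR_least_fixpoint X Y R \<Phi>"
proof -
  obtain \<Phi> where "\<Phi> \<in> Dom (EOR_ty X Y)" "EOR_op X Y R \<Phi> = \<Phi>"
    "\<forall>\<Psi>\<in>Dom (EOR_ty X Y). EOR_op X Y R \<Psi> = \<Psi> \<longrightarrow> \<Phi> \<subseteq> \<Psi>"
    using kleene_fixpoint[OF scott_cont_EOR_op[OF R, of Y]] by (elim bexE conjE)
  then have "EOR_least_fixpoint X Y R \<Phi>"
    by (simp add: EOR_least_fixpoint_def EOR_equation_iff_fixpoint[OF R])
  then show thesis by (rule that)
qed


section \<open>Totality by a minimal bad sequence\<close>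

text \<open>
  Choose \<open>u 0, u 1, \<dots>\<close> in turn, each \<open>r\<close>-minimal among the next entries of bad sequences that extend
  the choices made so far. The limit \<open>u\<close> itself need not be bad: only its initial segments have bad
  extensions.
\<close>

lemma minimal_bad_sequence:
  assumes wf: "wfp_on A r" and A: "\<And>s. bad s \<Longrightarrow> range s \<subseteq> A" and bad: "bad s0"
  shows "\<exists>u :: nat \<Rightarrow> 'a. (\<forall>n. \<exists>s. bad s \<and> (\<forall>i<n. s i = u i)) \<and>
    (\<forall>n s. bad s \<longrightarrow> (\<forall>i<n. s i = u i) \<longrightarrow> \<not> r (s n) (u n))"
proof -
  define P where "P u n x \<longleftrightarrow> (\<exists>s. bad s \<and> (\<forall>i<n. s i = u i) \<and> s n = x) \<and>
    (\<forall>s. bad s \<longrightarrow> (\<forall>i<n. s i = u i) \<longrightarrow> \<not> r (s n) x)" for u n x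
  have "\<exists>u. \<forall>n. P u n (u n)"
  proof (rule dependent_wellorder_choice)
    fix x and f g :: "nat \<Rightarrow> 'a" and n :: nat assume "\<And>i. i < n \<Longrightarrow> f i = g i"
    then show "P f n x = P g n x" unfolding P_def by simp
  next
    fix n f assume IH: "\<And>i. i < n \<Longrightarrow> P f i (f i)"
    have "\<exists>s. bad s \<and> (\<forall>i<n. s i = f i)"
    proof (cases n)
      case 0
      then show ?thesis using bad by auto
    next
      case (Suc m)
      then obtain s where "bad s" "\<forall>i<m. s i = f i" "s m = f m" using IH[of m] unfolding P_def by blast
      then show ?thesis using Suc less_Suc_eq by metis
    qed
    then have ne: "{s n | s. bad s \<and> (\<forall>i<n. s i = f i)} \<noteq> {}" by blast
    have "{s n | s. bad s \<and> (\<forall>i<n. s i = f i)} \<subseteq> A" using A by blast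
    then obtain x where "x \<in> {s n | s. bad s \<and> (\<forall>i<n. s i = f i)}"
      "\<And>y. r y x \<Longrightarrow> y \<notin> {s n | s. bad s \<and> (\<forall>i<n. s i = f i)}"
      using wf[unfolded wfp_on_iff_ex_minimal, rule_format, OF _ ne] by blast
    then show "\<exists>x. P f n x" unfolding P_def by blast
  qed
  then obtain u where u: "\<And>n. P u n (u n)" by blast
  show ?thesis
    by (rule exI[of _ u]) (use u[unfolded P_def] in blast)
qed

lemma ext_total: "(\<And>n. n < m \<Longrightarrow> is_total Z (\<alpha> \<bullet> num n)) \<Longrightarrow> is_total (Stream Z) (ext Z \<alpha> m)"
  unfolding ext_eq_stream_of by (rule stream_of_total) (simp add: total_zero)

lemma ext_cong: "(\<And>n. n < m \<Longrightarrow> \<alpha> \<bullet> num n = \<beta> \<bullet> num n) \<Longrightarrow> ext Z \<alpha> m = ext Z \<beta> m"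
  unfolding ext_eq_stream_of by (rule arg_cong[where f = stream_of]) (simp add: fun_eq_iff)

lemma spec_cong: "(\<And>n. \<alpha> \<bullet> num n = \<beta> \<bullet> num n) \<Longrightarrow> spec Z \<alpha> F = spec Z \<beta> F"
  unfolding spec_eq_stream_of using ext_cong[of _ \<alpha> \<beta> Z] by simp

text \<open>
  The continuity step: \<open>F\<close> obtains its value \<open>k\<close> at a total sequence from finitely many tokens, hence
  from an initial segment of some length \<open>N\<close>, so every longer truncation has the same value.
  Applying \<open>F\<close> to the strict version of \<open>\<alpha>\<close> matters here: \<open>\<alpha>\<close> itself may contain tokens with the
  empty condition, and no truncation contains those.
\<close>

lemma cutoff_exists:
  assumes F: "is_total (Stream Z \<rightarrow> Natural) F" and \<alpha>: "\<And>n. is_total Z (\<alpha> \<bullet> num n)"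
  obtains m k where "F \<bullet> ext Z \<alpha> m = num k" "k < m"
proof -
  let ?s = "\<lambda>n. \<alpha> \<bullet> num n"
  have "is_total Natural (F \<bullet> stream_of ?s)" by (intro total_app[OF F] stream_of_total \<alpha>)
  then obtain k where "F \<bullet> stream_of ?s = num k" by (rule total_NaturalE)
  then have "NatTok k \<in> F \<bullet> stream_of ?s" by (simp add: num_def)
  then obtain U where U: "Step U (NatTok k) \<in> F" "fset U \<subseteq> stream_of ?s" by (auto simp: app_def)
  obtain N where N: "\<And>s'. (\<forall>n<N. s' n = ?s n) \<Longrightarrow> fset U \<subseteq> stream_of s'"
    using finite_subset_stream_of[OF finite_fset U(2)] by blast
  \<comment> \<open>Long enough for \<open>F\<close> to see all it needs, and longer than the value it returns.\<close>
  let ?m = "max N (Suc k)"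
  have "fset U \<subseteq> ext Z \<alpha> ?m" unfolding ext_eq_stream_of by (rule N) (simp add: less_max_iff_disj)
  then have "NatTok k \<in> F \<bullet> ext Z \<alpha> ?m" using U(1) unfolding app_def by blast
  moreover have "is_total Natural (F \<bullet> ext Z \<alpha> ?m)" by (intro total_app[OF F] ext_total \<alpha>)
  ultimately have "F \<bullet> ext Z \<alpha> ?m = num k" by (intro Dom_Natural_eq_num total_Dom)
  then show thesis by (rule that) simp
qed

lemma foldr_cutoff:
  assumes "\<And>m. m \<in> set ms \<Longrightarrow> is_total Natural (f m)"
  shows "foldr (\<lambda>m E. nat_case (f m) (\<lambda>k. if k < m then z else E)) ms E =
    (if \<exists>m\<in>set ms. \<exists>k<m. f m = num k then z else E)"
  using assms
proof (induction ms)
  case (Cons m ms)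
  obtain k where "f m = num k" using Cons.prems[of m] by (auto elim: total_NaturalE)
  then show ?case using Cons by auto
qed simp

lemma spec_num:
  assumes "\<And>m. m \<le> n \<Longrightarrow> is_total Natural (F \<bullet> ext Z \<alpha> m)"
  shows "spec Z \<alpha> F \<bullet> num n =
    (if \<exists>m\<le>n. \<exists>k<m. F \<bullet> ext Z \<alpha> m = num k then zero Z else \<alpha> \<bullet> num n)"
proof -
  have "foldr (\<lambda>m E. nat_case (F \<bullet> ext Z \<alpha> m) (\<lambda>k. if k < m then zero Z else E)) [0..<Suc n] (\<alpha> \<bullet> num n) =
      (if \<exists>m\<in>set [0..<Suc n]. \<exists>k<m. F \<bullet> ext Z \<alpha> m = num k then zero Z else \<alpha> \<bullet> num n)"
    by (rule foldr_cutoff) (use assms in auto)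
  also have "(\<exists>m\<in>set [0..<Suc n]. \<exists>k<m. F \<bullet> ext Z \<alpha> m = num k) \<longleftrightarrow> (\<exists>m\<le>n. \<exists>k<m. F \<bullet> ext Z \<alpha> m = num k)"
    unfolding Bex_def by (simp only: set_upt atLeastLessThan_iff less_Suc_eq_le le0 simp_thms)
  finally show ?thesis unfolding spec_eq_stream_of stream_of_num .
qed

text \<open>The search is lazy: beyond a cutoff \<open>m\<close> neither \<open>F\<close> nor \<open>\<alpha>\<close> is looked at.\<close>

lemma spec_num_after_cutoff:
  assumes F: "\<And>j. j \<le> m \<Longrightarrow> is_total Natural (F \<bullet> ext Z \<alpha> j)"
    and m: "F \<bullet> ext Z \<alpha> m = num k" "k < m" and n: "m \<le> n"
  shows "spec Z \<alpha> F \<bullet> num n = zero Z"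
proof -
  let ?step = "\<lambda>m E. nat_case (F \<bullet> ext Z \<alpha> m) (\<lambda>k. if k < m then zero Z else E)"
  let ?E = "foldr ?step [Suc m..<Suc n] (\<alpha> \<bullet> num n)"
  have "[0..<Suc n] = [0..<Suc m] @ [Suc m..<Suc n]"
    using upt_add_eq_append[of 0 "Suc m" "n - m"] n by simp
  then have "spec Z \<alpha> F \<bullet> num n = foldr ?step [0..<Suc m] ?E"
    unfolding spec_eq_stream_of stream_of_num by (simp only: foldr_append)
  also have "\<dots> = (if \<exists>m\<in>set [0..<Suc m]. \<exists>k<m. F \<bullet> ext Z \<alpha> m = num k then zero Z else ?E)"
    by (rule foldr_cutoff) (use F in auto)
  also have "\<dots> = zero Z"
  proof -
    have "\<exists>m\<in>set [0..<Suc m]. \<exists>k<m. F \<bullet> ext Z \<alpha> m = num k" using m by (intro bexI[of _ m]) auto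
    then show ?thesis by simp
  qed
  finally show ?thesis .
qed

text \<open>
  The search stops at the cutoff, so nothing is required of \<open>\<alpha>\<close> from there on. This is what carries a
  property of the limit of bad sequences over to one of the bad sequences.
\<close>

lemma spec_total:
  assumes F: "is_total (Stream Z \<rightarrow> Natural) F" and \<alpha>: "\<And>i. i < m \<Longrightarrow> is_total Z (\<alpha> \<bullet> num i)"
    and m: "F \<bullet> ext Z \<alpha> m = num k" "k < m"
  shows "is_total (Stream Z) (spec Z \<alpha> F)"
proof -
  have ext: "is_total Natural (F \<bullet> ext Z \<alpha> j)" if "j \<le> m" for j
    using that by (intro total_app[OF F] ext_total \<alpha>) simp
  have "is_total Z (spec Z \<alpha> F \<bullet> num n)" for n
  proof (cases "n < m")
    case True
    then show ?thesis using spec_num[of n F Z \<alpha>] ext \<alpha> total_zero by simp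
  next
    case False
    then show ?thesis using spec_num_after_cutoff[OF ext m, of n] total_zero by simp
  qed
  then show ?thesis unfolding spec_eq_stream_of stream_of_num by (rule stream_of_total)
qed

lemma EOR_seq_num:
  assumes "R \<in> Dom (X \<rightarrow> X \<rightarrow> Boolean)" "\<Phi> \<in> Dom (EOR_ty X Y)" "H \<in> Dom (Stream (EOR_arg X Y) \<rightarrow> Y)"
    "F \<in> Dom (Stream (EOR_arg X Y) \<rightarrow> Natural)" "u \<in> Dom (Stream X)"
  shows "EOR_seq X Y R \<Phi> H F u \<bullet> num n = pair (u \<bullet> num n) (EOR_branch X Y R \<Phi> H F u (num n))"
  unfolding EOR_seq_def
  by (rule app_lam[OF _ num_Dom], rule scott_cont_pair, rule scott_cont_app_app,
      rule_tac [3] scott_cont_EOR_branch)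
    (blast intro: assms scott_cont_const scott_cont_id)+

lemma EOR_branch_app:
  assumes "R \<in> Dom (X \<rightarrow> X \<rightarrow> Boolean)" "\<Phi> \<in> Dom (EOR_ty X Y)" "H \<in> Dom (Stream (EOR_arg X Y) \<rightarrow> Y)"
    "F \<in> Dom (Stream (EOR_arg X Y) \<rightarrow> Natural)" "u \<in> Dom (Stream X)" "v \<in> Dom (Stream X)"
  shows "EOR_branch X Y R \<Phi> H F u (num n) \<bullet> v = if_else_zero Y
    (\<Phi> \<bullet> H \<bullet> F \<bullet> append_seq (initial_seg u (num n)) v) (below R (v \<bullet> num 0) (u \<bullet> num n))"
  by (rule app_lam[OF _ assms(6)], rule scott_cont_EOR_branch_body)
    (blast intro: assms scott_cont_const scott_cont_id num_Dom)+

text \<open>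
  The recursive calls at position \<open>n\<close> replace the entries of \<open>u\<close> from \<open>n\<close> on, and the value of \<open>u\<close> at
  the undefined number is not inspected.
\<close>

lemma EOR_seq_cong:
  assumes "R \<in> Dom (X \<rightarrow> X \<rightarrow> Boolean)" "\<Phi> \<in> Dom (EOR_ty X Y)" "H \<in> Dom (Stream (EOR_arg X Y) \<rightarrow> Y)"
    "F \<in> Dom (Stream (EOR_arg X Y) \<rightarrow> Natural)" "u \<in> Dom (Stream X)" "w \<in> Dom (Stream X)"
    and e: "\<And>i. i \<le> n \<Longrightarrow> u \<bullet> num i = w \<bullet> num i"
  shows "EOR_seq X Y R \<Phi> H F u \<bullet> num n = EOR_seq X Y R \<Phi> H F w \<bullet> num n"
proof -
  have "initial_seg u (num n) = initial_seg w (num n)"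
    unfolding initial_seg_def nat_case_num by (rule arg_cong[where f = seq]) (simp add: e)
  then show ?thesis
    unfolding EOR_seq_num[OF assms(1-5)] EOR_seq_num[OF assms(1-4,6)] by (simp add: e)
qed

lemma below_total:
  assumes "is_total (X \<rightarrow> X \<rightarrow> Boolean) R" "is_total X x" "is_total X y"
  obtains b where "below R y x = truth b"
  unfolding below_def by (rule total_BooleanE[OF total_app[OF total_app[OF assms(1,2)] assms(3)]])

lemma EOR_seq_total:
  assumes R: "is_total (X \<rightarrow> X \<rightarrow> Boolean) R" and "\<Phi> \<in> Dom (EOR_ty X Y)"
    "H \<in> Dom (Stream (EOR_arg X Y) \<rightarrow> Y)" "F \<in> Dom (Stream (EOR_arg X Y) \<rightarrow> Natural)"
    and u: "is_total (Stream X) u"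
    and below: "\<And>v. is_total (Stream X) v \<Longrightarrow> below R (v \<bullet> num 0) (u \<bullet> num n) = truth True \<Longrightarrow>
      is_total Y (\<Phi> \<bullet> H \<bullet> F \<bullet> append_seq (initial_seg u (num n)) v)"
  shows "is_total (EOR_arg X Y) (EOR_seq X Y R \<Phi> H F u \<bullet> num n)"
proof -
  note D = total_Dom[OF R] assms(2-4) total_Dom[OF u]
  have "is_total (Stream X \<rightarrow> Y) (EOR_branch X Y R \<Phi> H F u (num n))"
  proof (rule total_lam)
    show "scott_cont (Stream X) Y (\<lambda>v. if_else_zero Y (\<Phi> \<bullet> H \<bullet> F \<bullet> append_seq (initial_seg u (num n)) v)
        (below R (v \<bullet> num 0) (u \<bullet> num n)))"
      by (rule scott_cont_EOR_branch_body) (blast intro: D scott_cont_const scott_cont_id num_Dom)+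
    fix v assume v: "is_total (Stream X) v"
    obtain b where "below R (v \<bullet> num 0) (u \<bullet> num n) = truth b"
      by (rule below_total[OF R total_app[OF u total_num] total_app[OF v total_num]])
    then show "is_total Y (if_else_zero Y (\<Phi> \<bullet> H \<bullet> F \<bullet> append_seq (initial_seg u (num n)) v)
        (below R (v \<bullet> num 0) (u \<bullet> num n)))"
      using below[OF v] by (simp add: if_else_zero_def total_zero)
  qed
  then show ?thesis unfolding EOR_seq_num[OF D] by (intro total_pair total_app[OF u total_num])
qed

text \<open>
  Let \<open>w\<close> be the limit of minimal choices among the sequences with non-total value. A recursive call at
  position \<open>n\<close> of \<open>w\<close> goes to a sequence that agrees with \<open>w\<close> before \<open>n\<close> and is smaller at \<open>n\<close>; by
  minimality its value is total. So the argument sequence \<open>\<alpha> w\<close> is total and has a cutoff \<open>m\<close>. A bad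
  sequence \<open>s\<close> that agrees with \<open>w\<close> before \<open>m\<close> yields the same argument sequence before \<open>m\<close>, and
  nothing beyond \<open>m\<close> is looked at. Hence its value is total, a contradiction. The control \<open>F\<close> does the
  work of the openness assumption in ordinary open induction.
\<close>

lemma EOR_value_total:
  assumes R: "is_total (X \<rightarrow> X \<rightarrow> Boolean) R" and wf: "wellfounded_relation X R"
    and \<Phi>: "\<Phi> \<in> Dom (EOR_ty X Y)" "EOR_equation X Y R \<Phi>"
    and H: "is_total (Stream (EOR_arg X Y) \<rightarrow> Y) H"
    and F: "is_total (Stream (EOR_arg X Y) \<rightarrow> Natural) F"
    and u: "is_total (Stream X) u"
  shows "is_total Y (\<Phi> \<bullet> H \<bullet> F \<bullet> u)"
proof (rule ccontr)
  assume not_total: "\<not> is_total Y (\<Phi> \<bullet> H \<bullet> F \<bullet> u)"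
  let ?Z = "EOR_arg X Y"
  note D = total_Dom[OF R] \<Phi>(1) total_Dom[OF H] total_Dom[OF F]
  define \<alpha> where "\<alpha> w = EOR_seq X Y R \<Phi> H F w" for w
  have eq: "\<Phi> \<bullet> H \<bullet> F \<bullet> w = H \<bullet> spec ?Z (\<alpha> w) F" if "w \<in> Dom (Stream X)" for w
    using \<Phi>(2) D that unfolding EOR_equation_def \<alpha>_def by blast
  define bad where "bad s \<longleftrightarrow> (\<forall>n. is_total X (s n)) \<and> \<not> is_total Y (\<Phi> \<bullet> H \<bullet> F \<bullet> stream_of s)" for s
  \<comment> \<open>The value depends only on the entries at numerals, so \<open>u\<close> may be replaced by a strict stream.\<close>
  have bad_u: "bad (\<lambda>n. u \<bullet> num n)"
  proof -
    have s: "is_total (Stream X) (stream_of (\<lambda>n. u \<bullet> num n))"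
      by (intro stream_of_total total_app[OF u] total_num)
    have "spec ?Z (\<alpha> u) F = spec ?Z (\<alpha> (stream_of (\<lambda>n. u \<bullet> num n))) F"
      unfolding \<alpha>_def by (intro spec_cong EOR_seq_cong D u[THEN total_Dom] s[THEN total_Dom]) simp
    then show ?thesis
      using not_total total_app[OF u total_num] eq[OF total_Dom[OF u]] eq[OF total_Dom[OF s]]
      unfolding bad_def by simp
  qed
  have bad_total: "range s \<subseteq> {x. is_total X x}" if "bad s" for s using that by (auto simp: bad_def)
  obtain w where
    bad_extension: "\<And>n. \<exists>s. bad s \<and> (\<forall>i<n. s i = w i)" and
    minimal: "\<And>n s. bad s \<Longrightarrow> (\<forall>i<n. s i = w i) \<Longrightarrow> below R (s n) (w n) \<noteq> truth True"
    using minimal_bad_sequence[OF wf[unfolded wellfounded_relation_def], of bad, OF bad_total bad_u] by blast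
  have w_total: "is_total X (w n)" for n
    using bad_extension[of "Suc n"] unfolding bad_def by (metis lessI)
  let ?w = "stream_of w"
  have W: "is_total (Stream X) ?w" by (rule stream_of_total[OF w_total])
  have \<alpha>_total: "is_total ?Z (\<alpha> ?w \<bullet> num n)" for n
    unfolding \<alpha>_def
  proof (rule EOR_seq_total[OF R D(2-4) W])
    fix v assume v: "is_total (Stream X) v" "below R (v \<bullet> num 0) (?w \<bullet> num n) = truth True"
    \<comment> \<open>The sequence to which the recursive call goes.\<close>
    define s where "s k = (if k < n then w k else v \<bullet> num (k - n))" for k
    have "\<not> bad s" using minimal[of s n] v(2) by (auto simp: s_def)
    moreover have "is_total X (s i)" for i using w_total total_app[OF v(1) total_num] by (simp add: s_def)
    ultimately have "is_total Y (\<Phi> \<bullet> H \<bullet> F \<bullet> stream_of s)" by (simp add: bad_def)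
    then show "is_total Y (\<Phi> \<bullet> H \<bullet> F \<bullet> append_seq (initial_seg ?w (num n)) v)"
      unfolding append_initial_seg stream_of_num s_def[abs_def] .
  qed
  obtain m k where m: "F \<bullet> ext ?Z (\<alpha> ?w) m = num k" "k < m"
    by (rule cutoff_exists[OF F \<alpha>_total])
  obtain s where s: "bad s" "\<And>i. i < m \<Longrightarrow> s i = w i" using bad_extension[of m] by blast
  have S: "is_total (Stream X) (stream_of s)" by (rule stream_of_total) (use s(1) in \<open>simp add: bad_def\<close>)
  have agree: "\<alpha> (stream_of s) \<bullet> num i = \<alpha> ?w \<bullet> num i" if "i < m" for i
    unfolding \<alpha>_def by (intro EOR_seq_cong D S[THEN total_Dom] W[THEN total_Dom]) (use s(2) that in simp)
  have "is_total (Stream ?Z) (spec ?Z (\<alpha> (stream_of s)) F)"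
  proof (rule spec_total[OF F])
    show "is_total ?Z (\<alpha> (stream_of s) \<bullet> num i)" if "i < m" for i
      using \<alpha>_total agree[OF that] by simp
    show "F \<bullet> ext ?Z (\<alpha> (stream_of s)) m = num k"
      using m(1) ext_cong[of m "\<alpha> (stream_of s)" "\<alpha> ?w" ?Z] agree by simp
  qed (rule m(2))
  then have "is_total Y (\<Phi> \<bullet> H \<bullet> F \<bullet> stream_of s)"
    unfolding eq[OF total_Dom[OF S]] by (rule total_app[OF H])
  then show False using s(1) by (simp add: bad_def)
qed

lemma EOR_total:
  assumes R: "is_total (X \<rightarrow> X \<rightarrow> Boolean) R" and wf: "wellfounded_relation X R"
    and \<Phi>: "\<Phi> \<in> Dom (EOR_ty X Y)" "EOR_equation X Y R \<Phi>"
  shows "is_total (EOR_ty X Y) \<Phi>"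
proof -
  have 1: "is_total (Stream X \<rightarrow> Y) (\<Phi> \<bullet> H \<bullet> F)"
    if H: "is_total (Stream (EOR_arg X Y) \<rightarrow> Y) H" and F: "is_total (Stream (EOR_arg X Y) \<rightarrow> Natural) F" for H F
    by (rule total_functionI[OF app_Dom[OF app_Dom[OF \<Phi>(1) total_Dom[OF H]] total_Dom[OF F]]])
      (rule EOR_value_total[OF R wf \<Phi> H F])
  have "is_total ((Stream (EOR_arg X Y) \<rightarrow> Natural) \<rightarrow> Stream X \<rightarrow> Y) (\<Phi> \<bullet> H)"
    if H: "is_total (Stream (EOR_arg X Y) \<rightarrow> Y) H" for H
    by (rule total_functionI[OF app_Dom[OF \<Phi>(1) total_Dom[OF H]] 1[OF H]])
  then show ?thesis by (rule total_functionI[OF \<Phi>(1)])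
qed


section \<open>The equation in the total continuous functionals\<close>

lemma knth_cls: "is_total (Stream X) w \<Longrightarrow> knth X (cls (Stream X) w) n = cls X (w \<bullet> num n)"
  by (simp add: kapp_cls)

lemma kbelow_cls:
  assumes R: "is_total (X \<rightarrow> X \<rightarrow> Boolean) R" and x: "is_total X x" and y: "is_total X y"
  shows "kbelow X R (cls X y) (cls X x) \<longleftrightarrow> below R y x = truth True"
proof -
  obtain b where b: "below R y x = truth b" by (rule below_total[OF R x y])
  then show ?thesis
    unfolding kbelow_def kapp_cls[OF R x] kapp_cls[OF total_app[OF R x] y]
    by (simp add: below_def cls_truth_eq_iff)
qed

lemma kconcat_cls:
  assumes u: "is_total (Stream X) u" and v: "is_total (Stream X) v"
  shows "kconcat X (cls (Stream X) u) n (cls (Stream X) v) =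
    cls (Stream X) (append_seq (initial_seg u (num n)) v)"
proof -
  have "kconcat X (cls (Stream X) u) n (cls (Stream X) v) =
      kstream X (\<lambda>k. cls X (if k < n then u \<bullet> num k else v \<bullet> num (k - n)))"
    unfolding kconcat_def knth_cls[OF u] knth_cls[OF v] by (simp add: if_distrib)
  also have "\<dots> = cls (Stream X) (append_seq (initial_seg u (num n)) v)"
    unfolding append_initial_seg
    by (rule kstream_cls) (simp add: total_app[OF u] total_app[OF v])
  finally show ?thesis .
qed

lemma append_seq_total:
  assumes u: "is_total (Stream X) u" and v: "is_total (Stream X) v"
  shows "is_total (Stream X) (append_seq (initial_seg u (num n)) v)"
  unfolding append_initial_seg
  by (rule stream_of_total) (simp add: total_app[OF u] total_app[OF v])

lemma kext_cls:
  assumes \<alpha>: "is_total (Stream Z) \<alpha>"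
  shows "kext Z (cls (Stream Z) \<alpha>) m = cls (Stream Z) (ext Z \<alpha> m)"
proof -
  have "kext Z (cls (Stream Z) \<alpha>) m = kstream Z (\<lambda>n. cls Z (if n < m then \<alpha> \<bullet> num n else zero Z))"
    unfolding kext_def knth_cls[OF \<alpha>] by (simp add: if_distrib)
  also have "\<dots> = cls (Stream Z) (ext Z \<alpha> m)"
    unfolding ext_eq_stream_of
    by (rule kstream_cls) (simp add: total_app[OF \<alpha>] total_zero)
  finally show ?thesis .
qed

text \<open>
  On total arguments the lazy search is the plain condition used in the type structure of total
  continuous functionals.
\<close>

lemma kspec_cls:
  assumes \<alpha>: "is_total (Stream Z) \<alpha>" and F: "is_total (Stream Z \<rightarrow> Natural) F"
  shows "kspec Z (cls (Stream Z) \<alpha>) (cls (Stream Z \<rightarrow> Natural) F) = cls (Stream Z) (spec Z \<alpha> F)"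
proof -
  have ext: "is_total (Stream Z) (ext Z \<alpha> m)" for m
    by (rule ext_total) (rule total_app[OF \<alpha> total_num])
  have F_ext: "kapp Natural (cls (Stream Z \<rightarrow> Natural) F) (kext Z (cls (Stream Z) \<alpha>) m) = cls Natural (num k)
      \<longleftrightarrow> F \<bullet> ext Z \<alpha> m = num k" for m k
  proof -
    obtain j where "F \<bullet> ext Z \<alpha> m = num j" by (rule total_NaturalE[OF total_app[OF F ext]])
    then show ?thesis by (simp add: kext_cls[OF \<alpha>] kapp_cls[OF F ext] cls_num_eq_iff)
  qed
  have num: "spec Z \<alpha> F \<bullet> num n =
      (if \<exists>m\<le>n. \<exists>k<m. F \<bullet> ext Z \<alpha> m = num k then zero Z else \<alpha> \<bullet> num n)" for n
    by (rule spec_num) (rule total_app[OF F ext])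
  have "kspec Z (cls (Stream Z) \<alpha>) (cls (Stream Z \<rightarrow> Natural) F) = kstream Z (\<lambda>n. cls Z (spec Z \<alpha> F \<bullet> num n))"
    unfolding kspec_def F_ext num knth_cls[OF \<alpha>] by (simp add: if_distrib)
  also have "\<dots> = cls (Stream Z) (stream_of (\<lambda>n. spec Z \<alpha> F \<bullet> num n))"
    by (rule kstream_cls) (simp add: num total_zero total_app[OF \<alpha>])
  also have "stream_of (\<lambda>n. spec Z \<alpha> F \<bullet> num n) = spec Z \<alpha> F"
    unfolding spec_eq_stream_of stream_of_num ..
  finally show ?thesis .
qed

text \<open>
  The witness is the class of the argument sequence in the partial functionals. Passing to classes
  commutes with every operation in the equation.
\<close>

lemma KK_EOR_equation_cls:
  assumes R: "is_total (X \<rightarrow> X \<rightarrow> Boolean) R"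
    and \<Phi>: "is_total (EOR_ty X Y) \<Phi>" and eq: "EOR_equation X Y R \<Phi>"
  shows "KK_EOR_equation X Y R (cls (EOR_ty X Y) \<Phi>)"
  unfolding KK_EOR_equation_def Let_def
proof (intro ballI)
  let ?Z = "EOR_arg X Y"
  fix H' F' u' assume "H' \<in> KK (Stream ?Z \<rightarrow> Y)" "F' \<in> KK (Stream ?Z \<rightarrow> Natural)" "u' \<in> KK (Stream X)"
  then obtain H F u where H: "is_total (Stream ?Z \<rightarrow> Y) H" "H' = cls (Stream ?Z \<rightarrow> Y) H"
    and F: "is_total (Stream ?Z \<rightarrow> Natural) F" "F' = cls (Stream ?Z \<rightarrow> Natural) F"
    and u: "is_total (Stream X) u" "u' = cls (Stream X) u"
    by (auto elim!: KK_E)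
  note \<Phi>H = total_app[OF \<Phi> H(1)]
  note \<Phi>HF = total_app[OF \<Phi>H F(1)]
  have eor: "kapp Y (kapp (Stream X \<rightarrow> Y) (kapp ((Stream ?Z \<rightarrow> Natural) \<rightarrow> Stream X \<rightarrow> Y)
      (cls (EOR_ty X Y) \<Phi>) H') F') (cls (Stream X) w) = cls Y (\<Phi> \<bullet> H \<bullet> F \<bullet> w)"
    if w: "is_total (Stream X) w" for w
    unfolding H(2) F(2) kapp_cls[OF \<Phi> H(1)] kapp_cls[OF \<Phi>H F(1)] kapp_cls[OF \<Phi>HF w] ..
  note D = total_Dom[OF R] total_Dom[OF \<Phi>] total_Dom[OF H(1)] total_Dom[OF F(1)] total_Dom[OF u(1)]
  define \<alpha> where "\<alpha> = EOR_seq X Y R \<Phi> H F u"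
  have \<alpha>_num: "is_total ?Z (\<alpha> \<bullet> num n)" for n
    unfolding \<alpha>_def
    by (rule EOR_seq_total[OF R D(2-4) u(1)]) (rule total_app[OF \<Phi>HF append_seq_total[OF u(1)]])
  have \<alpha>: "is_total (Stream ?Z) \<alpha>"
  proof (rule total_functionI)
    note c = scott_cont_const[OF D(2)] scott_cont_const[OF D(3)] scott_cont_const[OF D(4)] scott_cont_const[OF D(5)]
    show "\<alpha> \<in> Dom (Stream ?Z)"
      unfolding \<alpha>_def by (rule scott_cont_Dom[OF scott_cont_EOR_seq[OF D(1) c] empty_Dom])
    show "is_total ?Z (\<alpha> \<bullet> n)" if "is_total Natural n" for n
      using \<alpha>_num by (auto intro: total_NaturalE[OF that])
  qed
  show "\<exists>\<alpha>\<in>KK (Stream ?Z).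
      (\<forall>n. kfst X (knth ?Z \<alpha> n) = knth X u' n \<and>
        (\<forall>v\<in>KK (Stream X). kapp Y (ksnd (Stream X \<rightarrow> Y) (knth ?Z \<alpha> n)) v =
          (if kbelow X R (knth X v 0) (knth X u' n)
           then kapp Y (kapp (Stream X \<rightarrow> Y) (kapp ((Stream ?Z \<rightarrow> Natural) \<rightarrow> Stream X \<rightarrow> Y)
             (cls (EOR_ty X Y) \<Phi>) H') F') (kconcat X u' n v)
           else cls Y (zero Y)))) \<and>
      kapp Y (kapp (Stream X \<rightarrow> Y) (kapp ((Stream ?Z \<rightarrow> Natural) \<rightarrow> Stream X \<rightarrow> Y)
        (cls (EOR_ty X Y) \<Phi>) H') F') u' = kapp Y H' (kspec ?Z \<alpha> F')"
  proof (intro bexI[OF _ KK_cls[OF \<alpha>]] conjI allI ballI)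
    fix n
    have \<alpha>_n: "\<alpha> \<bullet> num n = pair (u \<bullet> num n) (EOR_branch X Y R \<Phi> H F u (num n))"
      unfolding \<alpha>_def by (rule EOR_seq_num[OF D])
    show "kfst X (knth ?Z (cls (Stream ?Z) \<alpha>) n) = knth X u' n"
      unfolding u(2) knth_cls[OF \<alpha>] knth_cls[OF u(1)] kfst_cls[OF \<alpha>_num]
      unfolding \<alpha>_n pfst_pair ..
    fix v' assume "v' \<in> KK (Stream X)"
    then obtain v where v: "is_total (Stream X) v" "v' = cls (Stream X) v" by (rule KK_E)
    have t: "is_total X (u \<bullet> num n)" "is_total X (v \<bullet> num 0)"
      by (intro total_app[OF u(1)] total_app[OF v(1)] total_num)+
    obtain b where b: "below R (v \<bullet> num 0) (u \<bullet> num n) = truth b" by (rule below_total[OF R t])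
    show "kapp Y (ksnd (Stream X \<rightarrow> Y) (knth ?Z (cls (Stream ?Z) \<alpha>) n)) v' =
        (if kbelow X R (knth X v' 0) (knth X u' n)
         then kapp Y (kapp (Stream X \<rightarrow> Y) (kapp ((Stream ?Z \<rightarrow> Natural) \<rightarrow> Stream X \<rightarrow> Y)
           (cls (EOR_ty X Y) \<Phi>) H') F') (kconcat X u' n v')
         else cls Y (zero Y))"
      unfolding u(2) v(2) knth_cls[OF \<alpha>] knth_cls[OF u(1)] knth_cls[OF v(1)] ksnd_cls[OF \<alpha>_num]
        kapp_cls[OF total_psnd[OF \<alpha>_num] v(1)] kbelow_cls[OF R t] kconcat_cls[OF u(1) v(1)]
        eor[OF append_seq_total[OF u(1) v(1)]]
      unfolding \<alpha>_n psnd_pair EOR_branch_app[OF D total_Dom[OF v(1)]] b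
      by (simp add: if_else_zero_def)
  next
    obtain m k where "F \<bullet> ext ?Z \<alpha> m = num k" "k < m" by (rule cutoff_exists[OF F(1) \<alpha>_num])
    then have spec: "is_total (Stream ?Z) (spec ?Z \<alpha> F)" by (rule spec_total[OF F(1) \<alpha>_num])
    have "\<Phi> \<bullet> H \<bullet> F \<bullet> u = H \<bullet> spec ?Z \<alpha> F"
      using eq D unfolding EOR_equation_def \<alpha>_def by blast
    then show "kapp Y (kapp (Stream X \<rightarrow> Y) (kapp ((Stream ?Z \<rightarrow> Natural) \<rightarrow> Stream X \<rightarrow> Y)
        (cls (EOR_ty X Y) \<Phi>) H') F') u' = kapp Y H' (kspec ?Z (cls (Stream ?Z) \<alpha>) F')"
      unfolding u(2) eor[OF u(1)] unfolding H(2) F(2) kspec_cls[OF \<alpha> F(1)] kapp_cls[OF H(1) spec] by simp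
  qed
qed

theorem theorem7p8:
  fixes X Y :: ty and R :: "tok set"
  assumes "primrec_relation X R"
    and "wellfounded_relation X R"
    and "wf_recursion_definable X R"
  shows "\<exists>\<Phi>. EOR_least_fixpoint X Y R \<Phi> \<and> is_total (EOR_ty X Y) \<Phi> \<and>
           cls (EOR_ty X Y) \<Phi> \<in> KK (EOR_ty X Y) \<and>
           KK_EOR_equation X Y R (cls (EOR_ty X Y) \<Phi>)"
proof -
  have R: "is_total (X \<rightarrow> X \<rightarrow> Boolean) R" by (rule primrec_relation_total[OF assms(1)])
  obtain \<Phi> where \<Phi>: "EOR_least_fixpoint X Y R \<Phi>" by (rule EOR_least_fixpoint_exists[OF total_Dom[OF R]])
  then have "\<Phi> \<in> Dom (EOR_ty X Y)" and eq: "EOR_equation X Y R \<Phi>"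
    by (simp_all add: EOR_least_fixpoint_def)
  then have "is_total (EOR_ty X Y) \<Phi>" by (rule EOR_total[OF R assms(2)])
  with \<Phi> show ?thesis using KK_cls KK_EOR_equation_cls[OF R _ eq] by blast
qed

end
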